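(* Let $X$ be a finite dimensional CAT(0) cubed complex and let $W$ be a subcomplex of $X$. Then $W$ is locally convex in $X$ if and only if $W$ is combinatorially locally convex in $X$.
   Context: A cubed complex is a space $X$ obtained as a quotient $p:\hat X\to X$ of a disjoint union of Euclidean unit cubes $\hat X=\bigsqcup_{\lambda\in\Lambda}(I^{n_\lambda}\times\{\lambda\})$, $I=[0,1]$, by gluing faces through isometries; precisely, $p$ is injective on the interior of each face of each cube, and whenever $p(x_1)=p(x_2)$ with $x_1,x_2$ in cubes $\lambda_1,\lambda_2$, there is an isometry $h$ from the smallest face containing $x_1$ onto the smallest face containing $x_2$ with $p(y)=p(h(y))$ for all $y$ in the former. (The map $p$ need not be injective on a closed cube.) $X$ carries the length metric $d_X$ induced from the Euclidean metrics of the cubes: the distance between two points is the infimum of the lengths of paths that are finite concatenations of straight segments, each contained in (the image of) one cube. Its dimension is $\max n_\lambda$. A subcomplex is a union of closed cells (images of faces of cubes). A geodesic space is CAT(0) if every geodesic triangle is at least as thin as its comparison triangle in the Euclidean plane; such a space is uniquely geodesic. $X$ is a CAT(0) cubed complex if $(X,d_X)$ is a CAT(0) space. A subset $A$ of a uniquely geodesic space $X$ is convex in $X$ if for any distinct $a,b\in A$ the unique geodesic segment $[a,b]$ in $X$ is contained in $A$. A subset $W$ of $X$ is locally convex in $X$ if for every $x\in W$ there is $\epsilon>0$ such that $W\cap B_X(x,\epsilon)$ is convex in $X$, where $B_X(x,\epsilon)$ is the open $\epsilon$-ball in $X$ with center $x$. For a vertex $v$ of $X$, the geometric link $\mathrm{Lk}(v,X)$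 is the all-right spherical complex obtained by gluing, over all $v_\lambda\in p^{-1}(v)$ that are vertices of cubes $I^{n_\lambda}\times\{\lambda\}$, the spaces of directions of the cubes at $v_\lambda$ (each is a spherical simplex in $S^{n_\lambda-1}$ all of whose edges have length $\pi/2$), along the gluings induced by $p$. For a CAT(0) cubed complex $X$ it is a simplicial complex. For a vertex $v$ of a subcomplex $W$, $\mathrm{Lk}(v,W)$ is regarded as a subcomplex of $\mathrm{Lk}(v,X)$. A subcomplex $K$ of a simplicial complex $L$ is full if every simplex of $L$ all of whose vertices are in $K$ is contained in $K$. The subcomplex $W$ of $X$ is combinatorially locally convex in $X$ if $\mathrm{Lk}(v,W)$ is a full subcomplex of $\mathrm{Lk}(v,X)$ for every vertex $v$ of $W$. *)

theory Defs
  imports "HOL-Analysis.Analysis"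
begin

section \<open>Geodesics, convexity and the CAT(0) condition\<close>

definition geodesic_path :: "'x set \<Rightarrow> ('x \<Rightarrow> 'x \<Rightarrow> real) \<Rightarrow> 'x \<Rightarrow> 'x \<Rightarrow> (real \<Rightarrow> 'x) \<Rightarrow> bool" where
  "geodesic_path M d a b \<gamma> \<longleftrightarrow>
     \<gamma> 0 = a \<and> \<gamma> (d a b) = b \<and> \<gamma> ` {0..d a b} \<subseteq> M \<and>
     (\<forall>s\<in>{0..d a b}. \<forall>t\<in>{0..d a b}. d (\<gamma> s) (\<gamma> t) = \<bar>s - t\<bar>)"

definition geodesic_segment :: "'x set \<Rightarrow> ('x \<Rightarrow> 'x \<Rightarrow> real) \<Rightarrow> 'x \<Rightarrow> 'x \<Rightarrow> 'x set \<Rightarrow> bool" where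
  "geodesic_segment M d a b S \<longleftrightarrow> (\<exists>\<gamma>. geodesic_path M d a b \<gamma> \<and> S = \<gamma> ` {0..d a b})"

text \<open>\<open>P\<close> is a comparison point, on the Euclidean segment from \<open>A\<close> to \<open>B\<close>, of the point \<open>x\<close>
  of the geodesic segment \<open>S\<close> from \<open>a\<close> to \<open>b\<close>.\<close>

definition comparison_point ::
  "('x \<Rightarrow> 'x \<Rightarrow> real) \<Rightarrow> 'x \<Rightarrow> 'x set \<Rightarrow> real^2 \<Rightarrow> real^2 \<Rightarrow> 'x \<Rightarrow> real^2 \<Rightarrow> bool" where
  "comparison_point d a S A B x P \<longleftrightarrow> x \<in> S \<and> P \<in> closed_segment A B \<and> dist A P = d a x"

definition CAT0_space :: "'x set \<Rightarrow> ('x \<Rightarrow> 'x \<Rightarrow> real) \<Rightarrow> bool" where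
  "CAT0_space M d \<longleftrightarrow>
     Metric_space M d \<and>
     (\<forall>a\<in>M. \<forall>b\<in>M. \<exists>S. geodesic_segment M d a b S) \<and>
     (\<forall>a\<in>M. \<forall>b\<in>M. \<forall>c\<in>M. \<forall>S\<^sub>1 S\<^sub>2 S\<^sub>3. \<forall>A B C :: real^2.
        geodesic_segment M d a b S\<^sub>1 \<and> geodesic_segment M d b c S\<^sub>2 \<and> geodesic_segment M d c a S\<^sub>3 \<and>
        dist A B = d a b \<and> dist B C = d b c \<and> dist C A = d c a \<longrightarrow>
        (let comp = (\<lambda>x P. comparison_point d a S\<^sub>1 A B x P \<or>
                           comparison_point d b S\<^sub>2 B C x P \<or>
                           comparison_point d c S\<^sub>3 C A x P)
         in \<forall>x y P Q. comp x P \<and> comp y Q \<longrightarrow> d x y \<le> dist P Q))"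

text \<open>In a uniquely geodesic space (in particular in a CAT(0) space) at most one \<open>S\<close> satisfies
  \<open>geodesic_segment M d a b S\<close>, so that the universal quantifier speaks about the segment
  \<open>[a,b]\<close>.\<close>

definition geodesically_convex :: "'x set \<Rightarrow> ('x \<Rightarrow> 'x \<Rightarrow> real) \<Rightarrow> 'x set \<Rightarrow> bool" where
  "geodesically_convex M d A \<longleftrightarrow>
     A \<subseteq> M \<and> (\<forall>a\<in>A. \<forall>b\<in>A. a \<noteq> b \<longrightarrow> (\<forall>S. geodesic_segment M d a b S \<longrightarrow> S \<subseteq> A))"

definition locally_convex :: "'x set \<Rightarrow> ('x \<Rightarrow> 'x \<Rightarrow> real) \<Rightarrow> 'x set \<Rightarrow> bool" where
  "locally_convex M d W \<longleftrightarrow>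
     W \<subseteq> M \<and> (\<forall>x\<in>W. \<exists>\<epsilon>>0. geodesically_convex M d (W \<inter> Metric_space.mball M d x \<epsilon>))"


section \<open>Unit cubes\<close>

text \<open>Points of \<open>I\<^sup>n\<close> are extensional functions on \<open>{..<n}\<close>. A face is cut out by prescribing
  the coordinates in \<open>Z\<close> to be 0 and those in \<open>E\<close> to be 1.\<close>

definition unit_cube :: "nat \<Rightarrow> (nat \<Rightarrow> real) set" where
  "unit_cube n = {..<n} \<rightarrow>\<^sub>E {0..1}"

definition cube_vertices :: "nat \<Rightarrow> (nat \<Rightarrow> real) set" where
  "cube_vertices n = {..<n} \<rightarrow>\<^sub>E {0, 1}"

definition cube_dist :: "nat \<Rightarrow> (nat \<Rightarrow> real) \<Rightarrow> (nat \<Rightarrow> real) \<Rightarrow> real" where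
  "cube_dist n x y = L2_set (\<lambda>k. x k - y k) {..<n}"

definition cube_face :: "nat \<Rightarrow> nat set \<Rightarrow> nat set \<Rightarrow> (nat \<Rightarrow> real) set" where
  "cube_face n Z E = {x \<in> unit_cube n. (\<forall>k\<in>Z. x k = 0) \<and> (\<forall>k\<in>E. x k = 1)}"

definition cube_face_interior :: "nat \<Rightarrow> nat set \<Rightarrow> nat set \<Rightarrow> (nat \<Rightarrow> real) set" where
  "cube_face_interior n Z E = {x \<in> cube_face n Z E. \<forall>k\<in>{..<n} - (Z \<union> E). 0 < x k \<and> x k < 1}"

definition cube_faces :: "nat \<Rightarrow> (nat \<Rightarrow> real) set set" where
  "cube_faces n = {cube_face n Z E | Z E. Z \<subseteq> {..<n} \<and> E \<subseteq> {..<n} \<and> Z \<inter> E = {}}"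

definition smallest_face :: "nat \<Rightarrow> (nat \<Rightarrow> real) \<Rightarrow> (nat \<Rightarrow> real) set" where
  "smallest_face n x = \<Inter> {F \<in> cube_faces n. x \<in> F}"

definition move :: "nat \<Rightarrow> (nat \<Rightarrow> real) \<Rightarrow> (nat \<Rightarrow> real) \<Rightarrow> real \<Rightarrow> nat \<Rightarrow> real" where
  "move n w u t = (\<lambda>k\<in>{..<n}. w k + t * u k)"

text \<open>The space of directions at \<open>w\<close> of a face \<open>F\<close> of \<open>I\<^sup>n\<close>, as a subset of the unit sphere
  \<open>S\<^sup>n\<^sup>-\<^sup>1\<close>. It is empty if \<open>F = {w}\<close>.\<close>

definition directions :: "nat \<Rightarrow> (nat \<Rightarrow> real) set \<Rightarrow> (nat \<Rightarrow> real) \<Rightarrow> (nat \<Rightarrow> real) set" where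
  "directions n F w =
     {u \<in> extensional {..<n}. L2_set u {..<n} = 1 \<and> (\<exists>\<epsilon>>0. \<forall>t\<in>{0..\<epsilon>}. move n w u t \<in> F)}"


section \<open>Full subcomplexes\<close>

text \<open>A complex is given by the set of its closed simplices, each being a set of points; its
  vertices are the points \<open>x\<close> for which \<open>{x}\<close> is a simplex.\<close>

definition full_subcomplex :: "'a set set \<Rightarrow> 'a set set \<Rightarrow> bool" where
  "full_subcomplex K L \<longleftrightarrow>
     K \<subseteq> L \<and> (\<forall>\<sigma>\<in>L. (\<forall>x\<in>\<sigma>. {x} \<in> L \<longrightarrow> {x} \<in> K) \<longrightarrow> \<sigma> \<in> K)"


section \<open>Cubed complexes\<close>

locale cubed_complex =
  fixes \<Lambda> :: "'i set" and cdim :: "'i \<Rightarrow> nat" and p :: "'i \<times> (nat \<Rightarrow> real) \<Rightarrow> 'x"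
  assumes inj_on_face_interiors:
    "\<lbrakk>l \<in> \<Lambda>; Z \<subseteq> {..<cdim l}; E \<subseteq> {..<cdim l}; Z \<inter> E = {}\<rbrakk>
      \<Longrightarrow> inj_on p ({l} \<times> cube_face_interior (cdim l) Z E)"
  and gluing_isometry:
    "\<lbrakk>l\<^sub>1 \<in> \<Lambda>; l\<^sub>2 \<in> \<Lambda>; x\<^sub>1 \<in> unit_cube (cdim l\<^sub>1); x\<^sub>2 \<in> unit_cube (cdim l\<^sub>2); p (l\<^sub>1, x\<^sub>1) = p (l\<^sub>2, x\<^sub>2)\<rbrakk>
      \<Longrightarrow> \<exists>h. h ` smallest_face (cdim l\<^sub>1) x\<^sub>1 = smallest_face (cdim l\<^sub>2) x\<^sub>2 \<and>
            (\<forall>y\<in>smallest_face (cdim l\<^sub>1) x\<^sub>1. \<forall>z\<in>smallest_face (cdim l\<^sub>1) x\<^sub>1.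
                cube_dist (cdim l\<^sub>2) (h y) (h z) = cube_dist (cdim l\<^sub>1) y z) \<and>
            (\<forall>y\<in>smallest_face (cdim l\<^sub>1) x\<^sub>1. p (l\<^sub>1, y) = p (l\<^sub>2, h y))"
begin

definition points :: "'x set" where
  "points = p ` (SIGMA l:\<Lambda>. unit_cube (cdim l))"

definition finite_dimensional :: bool where
  "finite_dimensional \<longleftrightarrow> bdd_above (cdim ` \<Lambda>)"

text \<open>\<open>broken_path a b r\<close>: there is a path of length \<open>r\<close> from \<open>a\<close> to \<open>b\<close> that is a finite
  concatenation of straight segments, each in the image of one cube.\<close>

inductive broken_path :: "'x \<Rightarrow> 'x \<Rightarrow> real \<Rightarrow> bool" where
  trivial: "a \<in> points \<Longrightarrow> broken_path a a 0"
| segment: "\<lbrakk>l \<in> \<Lambda>; x \<in> unit_cube (cdim l); y \<in> unit_cube (cdim l); broken_path (p (l, y)) b r\<rbrakk>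
    \<Longrightarrow> broken_path (p (l, x)) b (cube_dist (cdim l) x y + r)"

text \<open>The extended distance is infinite between points that are not joined by any such path; the
  real-valued length metric is only meaningful where the extended distance is finite.\<close>

definition length_edist :: "'x \<Rightarrow> 'x \<Rightarrow> ennreal" where
  "length_edist a b = Inf {ennreal r | r. broken_path a b r}"

definition length_dist :: "'x \<Rightarrow> 'x \<Rightarrow> real" where
  "length_dist a b = enn2real (length_edist a b)"

definition CAT0 :: bool where
  "CAT0 \<longleftrightarrow> (\<forall>a\<in>points. \<forall>b\<in>points. length_edist a b < \<infinity>) \<and> CAT0_space points length_dist"

definition closed_cells :: "'x set set" where
  "closed_cells = {p ` ({l} \<times> F) | l F. l \<in> \<Lambda> \<and> F \<in> cube_faces (cdim l)}"

definition subcomplex :: "'x set \<Rightarrow> bool" where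
  "subcomplex W \<longleftrightarrow> (\<exists>C \<subseteq> closed_cells. W = \<Union> C)"

definition vertices :: "'x set" where
  "vertices = p ` (SIGMA l:\<Lambda>. cube_vertices (cdim l))"

text \<open>The disjoint union of the spaces of directions of the cubes at the vertices over \<open>v\<close>.\<close>

definition link_directions :: "'x \<Rightarrow> ('i \<times> (nat \<Rightarrow> real) \<times> (nat \<Rightarrow> real)) set" where
  "link_directions v =
     {(l, w, u). l \<in> \<Lambda> \<and> w \<in> cube_vertices (cdim l) \<and> p (l, w) = v \<and>
                 u \<in> directions (cdim l) (unit_cube (cdim l)) w}"

text \<open>The gluing induced by \<open>p\<close>: two directions are identified if \<open>p\<close> maps the segments issuing
  in these directions to the same path near \<open>v\<close>. By the axioms for \<open>p\<close> this happens iff some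
  isometry \<open>h\<close> between faces with \<open>p \<circ> h = p\<close> maps one vertex to the other and one
  direction to the other.\<close>

definition link_gluing ::
  "'x \<Rightarrow> (('i \<times> (nat \<Rightarrow> real) \<times> (nat \<Rightarrow> real)) \<times> ('i \<times> (nat \<Rightarrow> real) \<times> (nat \<Rightarrow> real))) set" where
  "link_gluing v =
     {((l\<^sub>1, w\<^sub>1, u\<^sub>1), (l\<^sub>2, w\<^sub>2, u\<^sub>2)).
        (l\<^sub>1, w\<^sub>1, u\<^sub>1) \<in> link_directions v \<and> (l\<^sub>2, w\<^sub>2, u\<^sub>2) \<in> link_directions v \<and>
        (\<exists>\<epsilon>>0. \<forall>t\<in>{0..\<epsilon>}. p (l\<^sub>1, move (cdim l\<^sub>1) w\<^sub>1 u\<^sub>1 t) = p (l\<^sub>2, move (cdim l\<^sub>2) w\<^sub>2 u\<^sub>2 t))}"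

definition link_point ::
  "'x \<Rightarrow> 'i \<times> (nat \<Rightarrow> real) \<times> (nat \<Rightarrow> real) \<Rightarrow> ('i \<times> (nat \<Rightarrow> real) \<times> (nat \<Rightarrow> real)) set" where
  "link_point v e = link_gluing v `` {e}"

text \<open>The (closed) simplices of \<open>Lk(v, W)\<close>, as subsets of the glued space
  \<open>link_directions v // link_gluing v\<close>. The cells of a subcomplex \<open>W\<close> are the images of those
  faces \<open>F\<close> that \<open>p\<close> maps into \<open>W\<close>, and each such face of positive dimension containing a
  vertex \<open>w\<close> over \<open>v\<close> contributes its space of directions at \<open>w\<close>. For \<open>W = points\<close>, these are
  the simplices of \<open>Lk(v, X)\<close>.\<close>

definition link :: "'x \<Rightarrow> 'x set \<Rightarrow> ('i \<times> (nat \<Rightarrow> real) \<times> (nat \<Rightarrow> real)) set set set" where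
  "link v W =
     {(\<lambda>u. link_point v (l, w, u)) ` directions (cdim l) F w | l w F.
        l \<in> \<Lambda> \<and> w \<in> cube_vertices (cdim l) \<and> p (l, w) = v \<and>
        F \<in> cube_faces (cdim l) \<and> w \<in> F \<and> F \<noteq> {w} \<and> p ` ({l} \<times> F) \<subseteq> W}"

definition combinatorially_locally_convex :: "'x set \<Rightarrow> bool" where
  "combinatorially_locally_convex W \<longleftrightarrow>
     (\<forall>v \<in> vertices \<inter> W. full_subcomplex (link v W) (link v points))"

lemma equiv_link_gluing: "equiv (link_directions v) (link_gluing v)"
proof (rule equivI)
  show "link_gluing v \<subseteq> link_directions v \<times> link_directions v"
    unfolding link_gluing_def by auto
  show "refl_on (link_directions v) (link_gluing v)"
    unfolding refl_on_def link_gluing_def by (auto intro: exI[of _ 1])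
  show "sym (link_gluing v)"
    unfolding sym_def link_gluing_def by fastforce
  show "trans (link_gluing v)"
  proof (rule transI, clarify)
    fix l1 w1 u1 l2 w2 u2 l3 w3 u3
    assume a: "((l1, w1, u1), (l2, w2, u2)) \<in> link_gluing v"
      and b: "((l2, w2, u2), (l3, w3, u3)) \<in> link_gluing v"
    from a obtain e where e: "e > 0" "\<And>t. t \<in> {0..e} \<Longrightarrow>
        p (l1, move (cdim l1) w1 u1 t) = p (l2, move (cdim l2) w2 u2 t)"
      unfolding link_gluing_def by auto
    from b obtain f where f: "f > 0" "\<And>t. t \<in> {0..f} \<Longrightarrow>
        p (l2, move (cdim l2) w2 u2 t) = p (l3, move (cdim l3) w3 u3 t)"
      unfolding link_gluing_def by auto
    have "\<forall>t\<in>{0..min e f}. p (l1, move (cdim l1) w1 u1 t) = p (l3, move (cdim l3) w3 u3 t)"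
      using e(2) f(2) by simp
    moreover have "min e f > 0" using e f by simp
    ultimately show "((l1, w1, u1), (l3, w3, u3)) \<in> link_gluing v"
      using a b unfolding link_gluing_def by blast
  qed
qed

end

end

theory Submission
  imports Defs
begin

text \<open>
  Near a point \<open>x\<close> every point of \<open>X\<close> is \<open>p (l, y)\<close> with \<open>y\<close> close to some \<open>c\<close> over \<open>x\<close> in the
  same cube. The gluing isometries are signed permutations of coordinates (\<open>face_isometry_coords\<close>)
  and carry centre to centre (\<open>chart_change\<close>). Hence a recipe in the displacements \<open>\<bar>y k - c k\<bar>\<close>,
  and in anything else that the gluings respect, defines a map on a neighbourhood of \<open>x\<close>. A
  real-valued map that is 1-Lipschitz on each cube is 1-Lipschitz for the length metric
  (\<open>chart_lipschitz\<close>). Both implications confront maps of this kind with the uniqueness of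
  geodesics in a CAT(0) space.

  The link of \<open>W\<close> at a vertex \<open>v\<close> is full iff \<open>W\<close> contains every face of a cube at \<open>v\<close> as soon as
  it contains the edges of that face at \<open>v\<close> (\<open>full_link_iff_spans_faces\<close>).

  If this holds at all vertices of \<open>W\<close>, then resetting to \<open>c\<close> all coordinates of \<open>y\<close> that lead out
  of \<open>W\<close> is a 1-Lipschitz retraction of a neighbourhood of \<open>x \<in> W\<close> onto its intersection with \<open>W\<close>.
  It moves a point of the geodesic between two points of \<open>W\<close> no farther from either end; by
  uniqueness it fixes that point, which therefore lies in \<open>W\<close>. As balls are convex, \<open>W\<close> is locally
  convex.

  Conversely, let \<open>W\<close> be locally convex and contain a face at \<open>v\<close> with edges \<open>A\<close> and one more edge
  \<open>a\<close> of a cube. Consider the straight segment from the point whose displacement is \<open>\<delta>\<close> in the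
  coordinates \<open>A\<close> to the point whose displacement is \<open>\<delta>\<close> in the coordinate \<open>a\<close>. The difference of
  coordinate \<open>a\<close> and the sum of the coordinates \<open>A\<close>, divided by the square root of \<open>card A + 1\<close>,
  is 1-Lipschitz near \<open>v\<close> and grows along the segment by its full length
  (\<open>opposite_corners_dist\<close>). So the segment is a geodesic and lies in \<open>W\<close>; its midpoint is
  interior to the face spanned by \<open>A\<close> and \<open>a\<close>, which is then contained in \<open>W\<close>. The Lipschitz
  estimate requires that a cube never has two edges at a vertex that are glued to each other
  (\<open>no_loops_in_link\<close>): in a square with such edges, the midpoint of the segment between two glued
  points of these edges would be joined to their common image by two different geodesics.
\<close>

section \<open>Faces of a cube\<close>

definition free :: "nat \<Rightarrow> (nat \<Rightarrow> real) \<Rightarrow> nat set" where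
  "free n x = {k. k < n \<and> 0 < x k \<and> x k < 1}"

text \<open>The face through \<open>w\<close> with coordinate directions \<open>A\<close>. This is a face of the cube only when
  the coordinates of \<open>w\<close> outside \<open>A\<close> are 0 or 1.\<close>

definition subcube :: "nat \<Rightarrow> (nat \<Rightarrow> real) \<Rightarrow> nat set \<Rightarrow> (nat \<Rightarrow> real) set" where
  "subcube n w A = {y \<in> unit_cube n. \<forall>k<n. k \<notin> A \<longrightarrow> y k = w k}"

lemma unit_cube_iff:
  "x \<in> unit_cube n \<longleftrightarrow> x \<in> extensional {..<n} \<and> (\<forall>k<n. 0 \<le> x k \<and> x k \<le> 1)"
  by (auto simp: unit_cube_def PiE_iff)

lemma cube_vertices_iff:
  "x \<in> cube_vertices n \<longleftrightarrow> x \<in> extensional {..<n} \<and> (\<forall>k<n. x k = 0 \<or> x k = 1)"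
  by (auto simp: cube_vertices_def PiE_iff)

lemma unit_cube_eqI:
  assumes "x \<in> unit_cube n" "y \<in> unit_cube n" "\<And>k. k < n \<Longrightarrow> x k = y k"
  shows "x = y"
  using assms by (intro extensionalityI[of _ "{..<n}"]) (auto simp: unit_cube_iff)

lemma subcube_subset: "subcube n w A \<subseteq> unit_cube n"
  by (auto simp: subcube_def)

lemma self_in_subcube: "w \<in> unit_cube n \<Longrightarrow> w \<in> subcube n w A"
  by (auto simp: subcube_def)

lemma subcube_mono: "A \<subseteq> B \<Longrightarrow> subcube n w A \<subseteq> subcube n w B"
  by (auto simp: subcube_def)

lemma free_subset: "free n x \<subseteq> {..<n}"
  by (auto simp: free_def)

lemma finite_free [simp]: "finite (free n x)"
  using free_subset finite_subset by blast

lemma not_free: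
  assumes "x \<in> unit_cube n" "k < n" "k \<notin> free n x"
  shows "x k = 0 \<or> x k = 1"
proof -
  have "0 \<le> x k" "x k \<le> 1" using assms by (auto simp: unit_cube_iff)
  moreover have "\<not> (0 < x k \<and> x k < 1)" using assms by (auto simp: free_def)
  ultimately show ?thesis by linarith
qed

lemma free_vertex: "w \<in> cube_vertices n \<Longrightarrow> free n w = {}"
  by (force simp: cube_vertices_iff free_def)

lemma vertex_if_free_empty:
  assumes "x \<in> unit_cube n" "free n x = {}"
  shows "x \<in> cube_vertices n"
  using not_free[OF assms(1)] assms by (auto simp: cube_vertices_iff unit_cube_iff)

lemma vertex_in_cube: "w \<in> cube_vertices n \<Longrightarrow> w \<in> unit_cube n"
  by (force simp: cube_vertices_iff unit_cube_iff)

lemma cube_face_as_subcube: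
  assumes "F \<in> cube_faces n" "w \<in> F"
  shows "\<exists>A. A \<subseteq> {..<n} \<and> F = subcube n w A \<and> (\<forall>k<n. k \<notin> A \<longrightarrow> w k = 0 \<or> w k = 1)"
proof -
  obtain Z E where ZE: "F = cube_face n Z E" "Z \<subseteq> {..<n}" "E \<subseteq> {..<n}" "Z \<inter> E = {}"
    using assms by (auto simp: cube_faces_def)
  have "F = subcube n w ({..<n} - Z - E)"
  proof (intro set_eqI iffI)
    fix z assume "z \<in> F"
    then show "z \<in> subcube n w ({..<n} - Z - E)"
      using assms(2) ZE by (auto simp: cube_face_def subcube_def)
  next
    fix z assume z: "z \<in> subcube n w ({..<n} - Z - E)"
    have "z k = w k" if "k \<in> Z \<union> E" for k
      using z that ZE(2,3) by (auto simp: subcube_def)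
    then show "z \<in> F" using assms(2) z ZE by (auto simp: cube_face_def subcube_def)
  qed
  moreover have "\<forall>k<n. k \<notin> {..<n} - Z - E \<longrightarrow> w k = 0 \<or> w k = 1"
  proof (intro allI impI)
    fix k assume "k < n" "k \<notin> {..<n} - Z - E"
    then have "k \<in> Z \<or> k \<in> E" by blast
    then show "w k = 0 \<or> w k = 1" using assms(2) unfolding ZE(1) cube_face_def by blast
  qed
  ultimately show ?thesis
    by (intro exI[of _ "{..<n} - Z - E"] conjI) (rule Diff_subset[THEN order_trans], rule Diff_subset)
qed

lemma subcube_in_cube_faces:
  assumes "A \<subseteq> {..<n}" "\<And>k. k < n \<Longrightarrow> k \<notin> A \<Longrightarrow> w k = 0 \<or> w k = 1"
  shows "subcube n w A = cube_face n {k. k < n \<and> k \<notin> A \<and> w k = 0} {k. k < n \<and> k \<notin> A \<and> w k = 1}"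
    and "subcube n w A \<in> cube_faces n"
proof -
  show eq: "subcube n w A = cube_face n {k. k < n \<and> k \<notin> A \<and> w k = 0} {k. k < n \<and> k \<notin> A \<and> w k = 1}"
  proof (intro set_eqI iffI)
    fix z assume "z \<in> cube_face n {k. k < n \<and> k \<notin> A \<and> w k = 0} {k. k < n \<and> k \<notin> A \<and> w k = 1}"
    then have z: "z \<in> unit_cube n" "\<And>k. k < n \<Longrightarrow> k \<notin> A \<Longrightarrow> w k = 0 \<Longrightarrow> z k = 0"
      "\<And>k. k < n \<Longrightarrow> k \<notin> A \<Longrightarrow> w k = 1 \<Longrightarrow> z k = 1" by (auto simp: cube_face_def)
    have "z k = w k" if "k < n" "k \<notin> A" for k
      using assms(2)[OF that] z(2,3)[OF that] by metis
    then show "z \<in> subcube n w A" using z(1) by (auto simp: subcube_def)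
  qed (auto simp: subcube_def cube_face_def)
  show "subcube n w A \<in> cube_faces n"
    unfolding cube_faces_def
    by (intro CollectI exI[of _ "{k. k < n \<and> k \<notin> A \<and> w k = 0}"] exI[of _ "{k. k < n \<and> k \<notin> A \<and> w k = 1}"] conjI eq)
      auto
qed

lemma smallest_face_eq:
  assumes x: "x \<in> unit_cube n"
  shows "smallest_face n x = subcube n x (free n x)"
proof
  have "subcube n x (free n x) \<in> cube_faces n"
    by (rule subcube_in_cube_faces(2)[OF free_subset not_free[OF x]])
  then show "smallest_face n x \<subseteq> subcube n x (free n x)"
    using self_in_subcube[OF x] unfolding smallest_face_def by blast
  show "subcube n x (free n x) \<subseteq> smallest_face n x"
    unfolding smallest_face_def
  proof (rule Inter_greatest)
    fix F assume "F \<in> {F \<in> cube_faces n. x \<in> F}"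
    then have "F \<in> cube_faces n" "x \<in> F" by auto
    then obtain A where A: "F = subcube n x A" "\<And>k. k < n \<Longrightarrow> k \<notin> A \<Longrightarrow> x k = 0 \<or> x k = 1"
      using cube_face_as_subcube by blast
    have "free n x \<subseteq> A"
    proof
      fix k assume "k \<in> free n x"
      then show "k \<in> A" using A(2)[of k] by (auto simp: free_def)
    qed
    then show "subcube n x (free n x) \<subseteq> F" unfolding A(1) by (rule subcube_mono)
  qed
qed

text \<open>This is the form in which the injectivity of \<open>p\<close> on open faces becomes applicable to points
  that have the same smallest face as \<open>x\<close>.\<close>

lemma smallest_face_interior:
  assumes x: "x \<in> unit_cube n"
    and y: "y \<in> subcube n x (free n x)" and yfree: "free n x \<subseteq> free n y"
  shows "y \<in> cube_face_interior n {k. k < n \<and> k \<notin> free n x \<and> x k = 0} {k. k < n \<and> k \<notin> free n x \<and> x k = 1}"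
proof -
  have "subcube n x (free n x) = cube_face n {k. k < n \<and> k \<notin> free n x \<and> x k = 0} {k. k < n \<and> k \<notin> free n x \<and> x k = 1}"
    by (rule subcube_in_cube_faces(1)[OF free_subset not_free[OF x]])
  then have "y \<in> cube_face n {k. k < n \<and> k \<notin> free n x \<and> x k = 0} {k. k < n \<and> k \<notin> free n x \<and> x k = 1}"
    using y by simp
  moreover have "0 < y k \<and> y k < 1"
    if "k \<in> {..<n} - ({k. k < n \<and> k \<notin> free n x \<and> x k = 0} \<union> {k. k < n \<and> k \<notin> free n x \<and> x k = 1})" for k
  proof -
    have "k \<in> free n x" using that not_free[OF x, of k] by auto
    then show ?thesis using yfree by (auto simp: free_def)
  qed
  ultimately show ?thesis by (simp add: cube_face_interior_def)
qed

section \<open>Euclidean distances in a cube\<close>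

lemma cube_dist_sq: "(cube_dist n x y)\<^sup>2 = (\<Sum>k<n. (x k - y k)\<^sup>2)"
  by (simp add: cube_dist_def L2_set_def sum_nonneg)

lemma cube_dist_nonneg [simp]: "0 \<le> cube_dist n x y"
  by (simp add: cube_dist_def)

lemma cube_dist_self [simp]: "cube_dist n x x = 0"
  by (simp add: cube_dist_def L2_set_def)

lemma cube_dist_commute: "cube_dist n x y = cube_dist n y x"
  by (simp add: cube_dist_def L2_set_def power2_commute)

lemma cube_dist_triangle: "cube_dist n x z \<le> cube_dist n x y + cube_dist n y z"
  unfolding cube_dist_def
  using L2_set_triangle_ineq[of "\<lambda>k. x k - y k" "\<lambda>k. y k - z k" "{..<n}"] by simp

lemma coord_le_cube_dist: "k < n \<Longrightarrow> \<bar>x k - y k\<bar> \<le> cube_dist n x y"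
  unfolding cube_dist_def using member_le_L2_set[of "{..<n}" k "\<lambda>k. \<bar>x k - y k\<bar>"]
  by (simp add: L2_set_def)

lemma cube_dist_mono:
  assumes "\<And>k. k < n \<Longrightarrow> \<bar>x k - y k\<bar> \<le> \<bar>x' k - y' k\<bar>"
  shows "cube_dist n x y \<le> cube_dist n x' y'"
proof -
  have "L2_set (\<lambda>k. \<bar>x k - y k\<bar>) {..<n} \<le> L2_set (\<lambda>k. \<bar>x' k - y' k\<bar>) {..<n}"
    by (rule L2_set_mono) (use assms in auto)
  then show ?thesis by (simp add: cube_dist_def L2_set_def)
qed

lemma two_coords_le_cube_dist:
  assumes "i < n" "j < n" "i \<noteq> j"
  shows "\<bar>x i - y i\<bar> + \<bar>x j - y j\<bar> \<le> sqrt 2 * cube_dist n x y"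
proof -
  define a b where "a = \<bar>x i - y i\<bar>" and "b = \<bar>x j - y j\<bar>"
  have "(\<Sum>k\<in>{i,j}. (x k - y k)\<^sup>2) \<le> (\<Sum>k<n. (x k - y k)\<^sup>2)"
    by (rule sum_mono2) (simp_all add: assms)
  then have "a\<^sup>2 + b\<^sup>2 \<le> (cube_dist n x y)\<^sup>2"
    using assms by (simp add: cube_dist_sq a_def b_def)
  moreover have "(a + b)\<^sup>2 \<le> 2 * (a\<^sup>2 + b\<^sup>2)"
    using zero_le_power2[of "a - b"] by (simp add: power2_eq_square algebra_simps)
  ultimately have "(a + b)\<^sup>2 \<le> (sqrt 2 * cube_dist n x y)\<^sup>2"
    by (simp add: power_mult_distrib)
  then have "a + b \<le> sqrt 2 * cube_dist n x y"
    by (rule power2_le_imp_le) simp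
  then show ?thesis by (simp add: a_def b_def)
qed

lemma cube_dist_sq_subcube:
  assumes "y \<in> subcube n w A" "z \<in> subcube n w A" "A \<subseteq> {..<n}"
  shows "(cube_dist n y z)\<^sup>2 = (\<Sum>k\<in>A. (y k - z k)\<^sup>2)"
  unfolding cube_dist_sq
  by (rule sum.mono_neutral_right) (use assms in \<open>auto simp: subcube_def\<close>)

text \<open>Only pairs of opposite corners realise the diameter of a face. An isometry therefore
  recognises the corners, and also the dimension.\<close>

lemma subcube_diameter:
  assumes "y \<in> subcube n w A" "z \<in> subcube n w A" "A \<subseteq> {..<n}"
  shows "(cube_dist n y z)\<^sup>2 \<le> card A"
    and "(cube_dist n y z)\<^sup>2 = card A \<Longrightarrow> k \<in> A \<Longrightarrow> y k = 0 \<or> y k = 1"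
proof -
  have fin: "finite A" by (rule finite_subset[OF assms(3)]) simp
  have le: "(y k - z k)\<^sup>2 \<le> 1" if "k \<in> A" for k
  proof -
    have "0 \<le> y k" "y k \<le> 1" "0 \<le> z k" "z k \<le> 1"
      using assms that by (auto simp: subcube_def unit_cube_iff)
    then have "\<bar>y k - z k\<bar> \<le> 1" by linarith
    then show ?thesis by (simp add: abs_square_le_1)
  qed
  show "(cube_dist n y z)\<^sup>2 \<le> card A"
    unfolding cube_dist_sq_subcube[OF assms]
    using sum_mono[of A "\<lambda>k. (y k - z k)\<^sup>2" "\<lambda>_. 1"] le by simp
  assume eq: "(cube_dist n y z)\<^sup>2 = card A" and k: "k \<in> A"
  have "(\<Sum>k\<in>A. 1 - (y k - z k)\<^sup>2) = 0"
    using eq unfolding cube_dist_sq_subcube[OF assms] by (simp add: sum_subtractf)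
  then have "1 - (y k - z k)\<^sup>2 = 0"
    using sum_nonneg_eq_0_iff[OF fin, of "\<lambda>k. 1 - (y k - z k)\<^sup>2"] le k by simp
  then have "y k - z k = 1 \<or> y k - z k = -1"
    by (simp add: power2_eq_1_iff)
  moreover have "0 \<le> y k" "y k \<le> 1" "0 \<le> z k" "z k \<le> 1"
    using assms k by (auto simp: subcube_def unit_cube_iff)
  ultimately show "y k = 0 \<or> y k = 1" by linarith
qed

section \<open>Isometries between faces of cubes\<close>

definition flip :: "bool \<Rightarrow> real \<Rightarrow> real" where
  "flip s t = (if s then 1 - t else t)"

text \<open>An isometry between faces permutes and reflects coordinates. Corners go to corners because
  they realise the diameter. A corner that differs from the lowest one in the single coordinate
  \<open>a\<close> has distance 1 to it, so its image differs from the image of the lowest corner in a single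
  coordinate \<open>\<tau> a\<close>. Finally, the coordinate \<open>a\<close> of a point is determined by its distances to these
  two corners.\<close>

lemma face_isometry_coords:
  assumes A: "A \<subseteq> {..<n}" and B: "B \<subseteq> {..<m}" and x: "x \<in> unit_cube n" and x': "x' \<in> unit_cube m"
    and onto: "h ` subcube n x A = subcube m x' B"
    and iso: "\<And>y z. \<lbrakk>y \<in> subcube n x A; z \<in> subcube n x A\<rbrakk> \<Longrightarrow> cube_dist m (h y) (h z) = cube_dist n y z"
  obtains \<pi> s where "bij_betw \<pi> B A"
    "\<And>y k. \<lbrakk>y \<in> subcube n x A; k \<in> B\<rbrakk> \<Longrightarrow> h y k = flip (s k) (y (\<pi> k))"
proof -
  have finA: "finite A" by (rule finite_subset[OF A]) simp
  have finB: "finite B" by (rule finite_subset[OF B]) simp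
  have into: "h y \<in> subcube m x' B" if "y \<in> subcube n x A" for y
    using onto that by blast
  define face_corner where "face_corner n x A S = (\<lambda>k\<in>{..<n}. if k \<in> A then (if k \<in> S then 1 else 0) else x k :: real)" for n A S and x :: "nat \<Rightarrow> real"
  have face_corner_in: "face_corner n x A S \<in> subcube n x A" if "x \<in> unit_cube n" for S n A and x :: "nat \<Rightarrow> real"
    using that by (auto simp: face_corner_def subcube_def unit_cube_iff)
  have antipodal: "(cube_dist n (face_corner n x A S) (face_corner n x A (- S)))\<^sup>2 = card A"
    if "A \<subseteq> {..<n}" "x \<in> unit_cube n" for S n A and x :: "nat \<Rightarrow> real"
  proof -
    have "(cube_dist n (face_corner n x A S) (face_corner n x A (- S)))\<^sup>2 = (\<Sum>k\<in>A. 1)"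
      unfolding cube_dist_sq_subcube[OF face_corner_in face_corner_in, OF that(2) that(2) that(1)]
      by (rule sum.cong) (use that in \<open>auto simp: face_corner_def\<close>)
    then show ?thesis by simp
  qed
  \<comment> \<open>Both faces have the same diameter.\<close>
  have card_eq: "card A = card B"
  proof (rule antisym)
    have "(cube_dist m (h (face_corner n x A {})) (h (face_corner n x A (- {}))))\<^sup>2 \<le> card B"
      by (rule subcube_diameter(1)[OF into into B]) (rule face_corner_in[OF x])+
    then show "card A \<le> card B"
      using iso[OF face_corner_in face_corner_in, OF x x] antipodal[OF A x] by (metis of_nat_le_iff)
    obtain y z where yz: "y \<in> subcube n x A" "z \<in> subcube n x A"
        "h y = face_corner m x' B {}" "h z = face_corner m x' B (- {})"
      using face_corner_in[OF x'] onto by (metis (no_types, lifting) imageE)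
    have "real (card B) = (cube_dist n y z)\<^sup>2"
      using iso[OF yz(1,2)] antipodal[OF B x', of "{}"] yz by simp
    then show "card B \<le> card A"
      using subcube_diameter(1)[OF yz(1,2) A] by simp
  qed
  have vertex: "h (face_corner n x A S) k = 0 \<or> h (face_corner n x A S) k = 1" if "k \<in> B" for S k
  proof (rule subcube_diameter(2)[OF into into B])
    show "(cube_dist m (h (face_corner n x A S)) (h (face_corner n x A (- S))))\<^sup>2 = real (card B)"
      using iso[OF face_corner_in face_corner_in, OF x x] antipodal[OF A x] card_eq by simp
  qed (use that face_corner_in x in auto)
  let ?o = "h (face_corner n x A {})"
  have diff: "\<exists>b\<in>B. h (face_corner n x A {a}) b = 1 - ?o b \<and> (\<forall>k\<in>B. k \<noteq> b \<longrightarrow> h (face_corner n x A {a}) k = ?o k)"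
    if a: "a \<in> A" for a
  proof -
    let ?c = "h (face_corner n x A {a})"
    let ?D = "{k\<in>B. ?c k \<noteq> ?o k}"
    have "(cube_dist n (face_corner n x A {a}) (face_corner n x A {}))\<^sup>2 = (\<Sum>k\<in>A. if k = a then 1 else 0)"
      unfolding cube_dist_sq_subcube[OF face_corner_in face_corner_in, OF x x A]
      by (rule sum.cong) (use A in \<open>auto simp: face_corner_def\<close>)
    then have "(cube_dist m ?c ?o)\<^sup>2 = 1"
      using a finA iso[OF face_corner_in face_corner_in, OF x x] by (simp add: sum.delta)
    moreover have "(cube_dist m ?c ?o)\<^sup>2 = (\<Sum>k\<in>B. if ?c k \<noteq> ?o k then 1 else 0)"
      unfolding cube_dist_sq_subcube[OF into into, OF face_corner_in face_corner_in, OF x x B]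
    proof (rule sum.cong[OF refl])
      fix k assume k: "k \<in> B"
      show "(?c k - ?o k)\<^sup>2 = (if ?c k \<noteq> ?o k then 1 else 0)"
        using vertex[OF k, of "{a}"] vertex[OF k, of "{}"] by (elim disjE) simp_all
    qed
    moreover have "\<dots> = card ?D"
      unfolding sum.inter_filter[OF finB, symmetric] by simp
    ultimately have "card ?D = 1" by simp
    then obtain b where b: "?D = {b}" by (auto simp: card_1_singleton_iff)
    then have "b \<in> B" "?c b \<noteq> ?o b" by auto
    moreover have "?c b = 1 - ?o b" using vertex[of b "{a}"] vertex[of b "{}"] calculation by auto
    ultimately show ?thesis using b by blast
  qed
  then obtain \<tau> where \<tau>: "\<And>a. a \<in> A \<Longrightarrow> \<tau> a \<in> B" "\<And>a. a \<in> A \<Longrightarrow> h (face_corner n x A {a}) (\<tau> a) = 1 - ?o (\<tau> a)"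
    "\<And>a k. a \<in> A \<Longrightarrow> k \<in> B \<Longrightarrow> k \<noteq> \<tau> a \<Longrightarrow> h (face_corner n x A {a}) k = ?o k"
    by metis
  have "inj_on \<tau> A"
  proof (rule inj_onI)
    fix a a' assume a: "a \<in> A" "a' \<in> A" "\<tau> a = \<tau> a'"
    have "h (face_corner n x A {a}) k = h (face_corner n x A {a'}) k" if "k \<in> B" for k
      using \<tau>(2,3)[OF a(1)] \<tau>(2,3)[OF a(2)] a(3) that by (cases "k = \<tau> a") auto
    then have "(cube_dist m (h (face_corner n x A {a})) (h (face_corner n x A {a'})))\<^sup>2 = 0"
      unfolding cube_dist_sq_subcube[OF into into, OF face_corner_in face_corner_in, OF x x B] by simp
    then have "cube_dist n (face_corner n x A {a}) (face_corner n x A {a'}) = 0"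
      using iso[OF face_corner_in face_corner_in, OF x x] by simp
    then have "\<bar>face_corner n x A {a} a - face_corner n x A {a'} a\<bar> \<le> 0"
      using coord_le_cube_dist[of a n "face_corner n x A {a}" "face_corner n x A {a'}"] a(1) A by auto
    then show "a = a'" using a A by (auto simp: face_corner_def split: if_splits)
  qed
  then have bij: "bij_betw \<tau> A B"
    using \<tau>(1) card_eq finB by (metis card_image card_subset_eq image_subsetI bij_betw_def)
  \<comment> \<open>The squared distances of \<open>y\<close> to the lowest corner and to its neighbour in direction \<open>a\<close> differ by
    \<open>2 * y a - 1\<close>.\<close>
  have coord: "h y (\<tau> a) = flip (?o (\<tau> a) = 1) (y a)" if y: "y \<in> subcube n x A" and a: "a \<in> A" for y a
  proof -
    let ?c = "face_corner n x A {a}" and ?z = "face_corner n x A {}"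
    have one: "(\<Sum>k\<in>A. (y k - ?z k)\<^sup>2) - (\<Sum>k\<in>A. (y k - ?c k)\<^sup>2) = 2 * y a - 1"
    proof -
      have "(\<Sum>k\<in>A. (y k - ?z k)\<^sup>2 - (y k - ?c k)\<^sup>2) = (\<Sum>k\<in>A. if k = a then 2 * y a - 1 else 0)"
        by (rule sum.cong) (use A in \<open>auto simp: face_corner_def power2_eq_square algebra_simps\<close>)
      then show ?thesis using a finA by (simp add: sum_subtractf sum.delta)
    qed
    have two: "(\<Sum>k\<in>B. (h y k - ?o k)\<^sup>2) - (\<Sum>k\<in>B. (h y k - h ?c k)\<^sup>2)
        = (h y (\<tau> a) - ?o (\<tau> a))\<^sup>2 - (h y (\<tau> a) - (1 - ?o (\<tau> a)))\<^sup>2"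
    proof -
      have "(\<Sum>k\<in>B. (h y k - ?o k)\<^sup>2 - (h y k - h ?c k)\<^sup>2)
          = (\<Sum>k\<in>B. if k = \<tau> a then (h y (\<tau> a) - ?o (\<tau> a))\<^sup>2 - (h y (\<tau> a) - (1 - ?o (\<tau> a)))\<^sup>2 else 0)"
        by (rule sum.cong) (use \<tau>[OF a] in auto)
      then show ?thesis using \<tau>(1)[OF a] finB by (simp add: sum_subtractf sum.delta)
    qed
    have "2 * y a - 1 = (h y (\<tau> a) - ?o (\<tau> a))\<^sup>2 - (h y (\<tau> a) - (1 - ?o (\<tau> a)))\<^sup>2"
      using one two iso[OF y face_corner_in[OF x, of A "{}"]] iso[OF y face_corner_in[OF x, of A "{a}"]]
        cube_dist_sq_subcube[OF y face_corner_in[OF x] A] cube_dist_sq_subcube[OF into[OF y] into[OF face_corner_in[OF x]] B]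
      by metis
    then show ?thesis
      using vertex[OF \<tau>(1)[OF a], of "{}"] by (auto simp: flip_def power2_eq_square algebra_simps)
  qed
  show thesis
  proof (rule that)
    show "bij_betw (inv_into A \<tau>) B A" using bij by (rule bij_betw_inv_into)
    fix y k assume "y \<in> subcube n x A" "k \<in> B"
    then show "h y k = flip (?o k = 1) (y (inv_into A \<tau> k))"
      using coord[of y "inv_into A \<tau> k"] bij
      by (metis bij_betw_def bij_betw_inv_into_right inv_into_into)
  qed
qed

context cubed_complex
begin

section \<open>Gluings in coordinates\<close>

definition lifts :: "'x \<Rightarrow> ('i \<times> (nat \<Rightarrow> real)) set" where
  "lifts x = {(l, y). l \<in> \<Lambda> \<and> y \<in> unit_cube (cdim l) \<and> p (l, y) = x}"

lemma points_iff_lift: "x \<in> points \<longleftrightarrow> (\<exists>l y. (l, y) \<in> lifts x)"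
  by (auto simp: points_def lifts_def)

lemma lifts_in_points: "(l, y) \<in> lifts x \<Longrightarrow> x \<in> points"
  using points_iff_lift by blast

lemma lift_self: "\<lbrakk>l \<in> \<Lambda>; y \<in> unit_cube (cdim l)\<rbrakk> \<Longrightarrow> (l, y) \<in> lifts (p (l, y))"
  by (simp add: lifts_def)

text \<open>A gluing isometry \<open>h\<close> from the smallest face of \<open>x\<close> to that of \<open>x'\<close>: the coordinate \<open>k\<close> of
  \<open>h y\<close> is the coordinate \<open>\<pi> k\<close> of \<open>y\<close>, reflected if \<open>s k\<close>.\<close>

definition transports ::
  "'i \<Rightarrow> (nat \<Rightarrow> real) \<Rightarrow> 'i \<Rightarrow> (nat \<Rightarrow> real) \<Rightarrow> ((nat \<Rightarrow> real) \<Rightarrow> nat \<Rightarrow> real) \<Rightarrow> (nat \<Rightarrow> nat) \<Rightarrow> (nat \<Rightarrow> bool) \<Rightarrow> bool"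
  where
  "transports l x l' x' h \<pi> s \<longleftrightarrow>
     bij_betw \<pi> (free (cdim l') x') (free (cdim l) x) \<and> h x = x' \<and>
     (\<forall>y\<in>subcube (cdim l) x (free (cdim l) x).
        h y \<in> subcube (cdim l') x' (free (cdim l') x') \<and> p (l', h y) = p (l, y) \<and>
        (\<forall>k\<in>free (cdim l') x'. h y k = flip (s k) (y (\<pi> k)))) \<and>
     (\<forall>y\<in>subcube (cdim l) x (free (cdim l) x). \<forall>z\<in>subcube (cdim l) x (free (cdim l) x).
        cube_dist (cdim l') (h y) (h z) = cube_dist (cdim l) y z)"

lemma inj_on_open_face:
  assumes l: "l \<in> \<Lambda>" and x: "x \<in> unit_cube (cdim l)"
    and y: "y \<in> subcube (cdim l) x (free (cdim l) x)" "free (cdim l) x \<subseteq> free (cdim l) y"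
    and z: "z \<in> subcube (cdim l) x (free (cdim l) x)" "free (cdim l) x \<subseteq> free (cdim l) z"
    and eq: "p (l, y) = p (l, z)"
  shows "y = z"
proof -
  let ?Z = "{k. k < cdim l \<and> k \<notin> free (cdim l) x \<and> x k = 0}"
  let ?E = "{k. k < cdim l \<and> k \<notin> free (cdim l) x \<and> x k = 1}"
  have "inj_on p ({l} \<times> cube_face_interior (cdim l) ?Z ?E)"
    by (rule inj_on_face_interiors[OF l]) auto
  moreover have "y \<in> cube_face_interior (cdim l) ?Z ?E" "z \<in> cube_face_interior (cdim l) ?Z ?E"
    using smallest_face_interior[OF x] y z by blast+
  ultimately have "(l, y) = (l, z)" using eq by (auto dest: inj_onD)
  then show ?thesis by simp
qed

lemma flip_less: "0 < flip s t \<longleftrightarrow> (if s then t < 1 else 0 < t)" "flip s t < 1 \<longleftrightarrow> (if s then 0 < t else t < 1)"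
  by (auto simp: flip_def)

text \<open>The isometry sends \<open>x\<close> to an interior point of the smallest face of \<open>x'\<close> with the same image
  as \<open>x'\<close>, and so to \<open>x'\<close> itself.\<close>

lemma ex_transport:
  assumes x: "(l, x) \<in> lifts q" and x': "(l', x') \<in> lifts q"
  obtains h \<pi> s where "transports l x l' x' h \<pi> s"
proof -
  let ?n = "cdim l" and ?n' = "cdim l'"
  let ?F = "subcube ?n x (free ?n x)" and ?F' = "subcube ?n' x' (free ?n' x')"
  have l: "l \<in> \<Lambda>" "l' \<in> \<Lambda>" and cube: "x \<in> unit_cube ?n" "x' \<in> unit_cube ?n'"
    and eq: "p (l, x) = p (l', x')"
    using x x' by (auto simp: lifts_def)
  obtain h where h: "h ` ?F = ?F'"
      "\<And>y z. \<lbrakk>y \<in> ?F; z \<in> ?F\<rbrakk> \<Longrightarrow> cube_dist ?n' (h y) (h z) = cube_dist ?n y z"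
      "\<And>y. y \<in> ?F \<Longrightarrow> p (l, y) = p (l', h y)"
    using gluing_isometry[OF l cube eq] unfolding smallest_face_eq[OF cube(1)] smallest_face_eq[OF cube(2)]
    by blast
  obtain \<pi> s where \<pi>: "bij_betw \<pi> (free ?n' x') (free ?n x)"
      "\<And>y k. \<lbrakk>y \<in> ?F; k \<in> free ?n' x'\<rbrakk> \<Longrightarrow> h y k = flip (s k) (y (\<pi> k))"
    using face_isometry_coords[OF free_subset free_subset cube h(1,2)] by blast
  have xF: "x \<in> ?F" by (rule self_in_subcube[OF cube(1)])
  have hx: "h x \<in> ?F'" using h(1) xF by blast
  have "free ?n' x' \<subseteq> free ?n' (h x)"
  proof
    fix k assume k: "k \<in> free ?n' x'"
    then have "\<pi> k \<in> free ?n x" using \<pi>(1) bij_betwE by blast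
    then show "k \<in> free ?n' (h x)" using \<pi>(2)[OF xF k] k by (auto simp: free_def flip_less)
  qed
  then have "h x = x'"
    using inj_on_open_face[OF l(2) cube(2) hx _ self_in_subcube[OF cube(2)]] h(3)[OF xF] eq by simp
  moreover have "h y \<in> ?F'" if "y \<in> ?F" for y using h(1) that by blast
  ultimately have "transports l x l' x' h \<pi> s"
    using h \<pi> unfolding transports_def by simp
  then show thesis by (rule that)
qed

lemma transports_lift:
  assumes "transports l x l' x' h \<pi> s" "(l', x') \<in> lifts q" "y \<in> subcube (cdim l) x (free (cdim l) x)"
  shows "(l', h y) \<in> lifts (p (l, y))"
  using assms by (auto simp: transports_def lifts_def subcube_def)

lemma transports_fixed:
  assumes "transports l x l' x' h \<pi> s" "y \<in> subcube (cdim l) x (free (cdim l) x)" "k < cdim l'"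
    "k \<notin> free (cdim l') x'"
  shows "h y k = x' k"
  using assms by (auto simp: transports_def subcube_def)

lemma transports_coord:
  assumes "transports l x l' x' h \<pi> s" "y \<in> subcube (cdim l) x (free (cdim l) x)" "k \<in> free (cdim l') x'"
  shows "h y k = flip (s k) (y (\<pi> k))"
  using assms by (auto simp: transports_def)

lemma transports_perm: "\<lbrakk>transports l x l' x' h \<pi> s; k \<in> free (cdim l') x'\<rbrakk> \<Longrightarrow> \<pi> k \<in> free (cdim l) x"
  using bij_betwE unfolding transports_def by blast

text \<open>Some closed cell of \<open>W\<close> contains \<open>q\<close>, and a gluing carries the smallest face of \<open>y\<close> into
  that cell. So membership in \<open>W\<close> of a single point decides about its whole smallest face.\<close>

lemma subcomplex_contains_face:
  assumes W: "subcomplex W" and y: "(l, y) \<in> lifts q" and q: "q \<in> W"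
    and z: "z \<in> subcube (cdim l) y A" "A \<subseteq> free (cdim l) y"
  shows "p (l, z) \<in> W"
proof -
  obtain C where C: "C \<subseteq> closed_cells" "W = \<Union> C" using W unfolding subcomplex_def by blast
  then obtain c where c: "c \<in> C" "q \<in> c" using q by blast
  then obtain l' F where F: "c = p ` ({l'} \<times> F)" "l' \<in> \<Lambda>" "F \<in> cube_faces (cdim l')"
    using C by (auto simp: closed_cells_def)
  then obtain y' where y': "y' \<in> F" "q = p (l', y')" using c by auto
  obtain B where B: "F = subcube (cdim l') y' B" "\<forall>k<cdim l'. k \<notin> B \<longrightarrow> y' k = 0 \<or> y' k = 1"
    using cube_face_as_subcube[OF F(3) y'(1)] by blast
  have "y' \<in> unit_cube (cdim l')" using y' B subcube_subset by blast
  then have ly': "(l', y') \<in> lifts q" using F(2) y'(2) by (simp add: lifts_def)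
  obtain h \<pi> s where h: "transports l y l' y' h \<pi> s" using ex_transport[OF y ly'] .
  have z: "z \<in> subcube (cdim l) y (free (cdim l) y)" using z subcube_mono by blast
  have "free (cdim l') y' \<subseteq> B" using B(2) by (force simp: free_def)
  then have "h z \<in> F" using h z B(1) subcube_mono unfolding transports_def by blast
  moreover have "p (l', h z) = p (l, z)" using h z unfolding transports_def by blast
  moreover have "p (l', h z) \<in> c" unfolding F(1) using calculation(1) by blast
  ultimately have "p (l, z) \<in> c" by simp
  then show ?thesis using c C by blast
qed

section \<open>Neighbourhoods of a point\<close>

text \<open>All lifts of \<open>x\<close> have the same free coordinates up to reflection and order, so that a single
  \<open>\<epsilon>\<close> bounds them away from 0 and 1, however many cubes meet at \<open>x\<close>.\<close>

definition separated :: "'x \<Rightarrow> real \<Rightarrow> bool" where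
  "separated x \<epsilon> \<longleftrightarrow> 0 < \<epsilon> \<and> \<epsilon> \<le> 1/2 \<and>
     (\<forall>(l, c)\<in>lifts x. \<forall>k\<in>free (cdim l) c. \<epsilon> \<le> c k \<and> c k \<le> 1 - \<epsilon>)"

lemma ex_separated:
  assumes "x \<in> points"
  obtains \<epsilon> where "separated x \<epsilon>"
proof -
  obtain l c where c: "(l, c) \<in> lifts x" using assms points_iff_lift by blast
  let ?S = "insert (1/2) ((\<lambda>k. min (c k) (1 - c k)) ` free (cdim l) c)"
  define \<epsilon> where "\<epsilon> = Min ?S"
  have fin: "finite ?S" by simp
  have pos: "0 < \<epsilon>" unfolding \<epsilon>_def by (subst Min_gr_iff) (auto simp: free_def)
  have le: "\<epsilon> \<le> a" if "a \<in> ?S" for a unfolding \<epsilon>_def using fin that by (rule Min_le)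
  have "\<epsilon> \<le> c' k \<and> c' k \<le> 1 - \<epsilon>" if c': "(l', c') \<in> lifts x" and k: "k \<in> free (cdim l') c'" for l' c' k
  proof -
    obtain h \<pi> s where h: "transports l c l' c' h \<pi> s" using ex_transport[OF c c'] .
    have "c \<in> subcube (cdim l) c (free (cdim l) c)"
      using c by (intro self_in_subcube) (simp add: lifts_def)
    then have "c' k = flip (s k) (c (\<pi> k))" using h transports_coord[OF h _ k] unfolding transports_def by metis
    moreover have "\<epsilon> \<le> min (c (\<pi> k)) (1 - c (\<pi> k))"
      by (rule le) (use transports_perm[OF h k] in blast)
    ultimately show ?thesis by (auto simp: flip_def)
  qed
  then have "separated x \<epsilon>" using pos le[of "1/2"] unfolding separated_def by auto
  then show thesis by (rule that)
qed

text \<open>Coordinates of a lift that are not free are at distance at least \<open>\<epsilon>\<close> from all other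
  admissible values. So close lifts have the same smallest face, on whose interior \<open>p\<close> is
  injective.\<close>

lemma lifts_separated:
  assumes sep: "separated x \<epsilon>" and c: "(l, c) \<in> lifts x" "(l, c') \<in> lifts x"
    and close: "\<And>k. k < cdim l \<Longrightarrow> \<bar>c k - c' k\<bar> < \<epsilon>"
  shows "c = c'"
proof -
  let ?n = "cdim l"
  have l: "l \<in> \<Lambda>" "c \<in> unit_cube ?n" "c' \<in> unit_cube ?n" "p (l, c) = p (l, c')"
    using c by (auto simp: lifts_def)
  have eps: "0 < \<epsilon>" "\<epsilon> \<le> 1/2" using sep by (auto simp: separated_def)
  have bd: "\<epsilon> \<le> a k \<and> a k \<le> 1 - \<epsilon>" if "(l, a) \<in> lifts x" "k \<in> free ?n a" for a k
    using sep that unfolding separated_def by blast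
  have sub: "free ?n a \<subseteq> free ?n b"
    if "(l, a) \<in> lifts x" "\<And>k. k < cdim l \<Longrightarrow> \<bar>a k - b k\<bar> < \<epsilon>" for a b
  proof
    fix k assume k: "k \<in> free ?n a"
    then have "k < ?n" by (simp add: free_def)
    then show "k \<in> free ?n b" using bd[OF that(1) k] that(2)[of k] by (auto simp: free_def)
  qed
  have free_eq: "free ?n c = free ?n c'"
  proof
    show "free ?n c \<subseteq> free ?n c'" using sub[OF c(1)] close by blast
    show "free ?n c' \<subseteq> free ?n c" using sub[OF c(2), of c] close by (simp add: abs_minus_commute)
  qed
  have "c' k = c k" if k: "k < ?n" "k \<notin> free ?n c" for k
  proof -
    have "c k = 0 \<or> c k = 1" by (rule not_free[OF l(2) k])
    moreover have "c' k = 0 \<or> c' k = 1" by (rule not_free[OF l(3)]) (use k free_eq in auto)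
    ultimately show ?thesis using close[OF k(1)] eps by auto
  qed
  then have "c' \<in> subcube ?n c (free ?n c)" using l(3) by (simp add: subcube_def)
  then show ?thesis
    using inj_on_open_face[OF l(1,2) self_in_subcube[OF l(2)] order_refl, of c'] free_eq l(4) by simp
qed

text \<open>A point \<open>p (l, y)\<close> near \<open>x\<close>, together with the lift \<open>c\<close> of \<open>x\<close> that serves as origin. The
  same point may have many such descriptions.\<close>

definition near :: "'x \<Rightarrow> real \<Rightarrow> 'i \<Rightarrow> (nat \<Rightarrow> real) \<Rightarrow> (nat \<Rightarrow> real) \<Rightarrow> bool" where
  "near x r l c y \<longleftrightarrow> (l, c) \<in> lifts x \<and> y \<in> unit_cube (cdim l) \<and> cube_dist (cdim l) c y < r"

lemma near_lift: "near x r l c y \<Longrightarrow> (l, y) \<in> lifts (p (l, y))"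
  by (auto simp: near_def lifts_def)

lemma near_mono: "\<lbrakk>near x r l c y; r \<le> r'\<rbrakk> \<Longrightarrow> near x r' l c y"
  by (auto simp: near_def)

text \<open>Coordinates that are free at \<open>c\<close> remain free at \<open>y\<close>. Hence the gluing isometries available
  at \<open>y\<close> are also defined at \<open>c\<close>.\<close>

lemma near_center_in_face:
  assumes sep: "separated x \<epsilon>" and y: "near x (\<epsilon>/2) l c y"
  shows "c \<in> subcube (cdim l) y (free (cdim l) y)" and "free (cdim l) c \<subseteq> free (cdim l) y"
proof -
  let ?n = "cdim l"
  have cube: "c \<in> unit_cube ?n" "y \<in> unit_cube ?n" and c: "(l, c) \<in> lifts x"
    using y by (auto simp: near_def lifts_def)
  have eps: "0 < \<epsilon>" "\<epsilon> \<le> 1/2" using sep by (auto simp: separated_def)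
  have close: "\<bar>c k - y k\<bar> < \<epsilon>/2" if "k < ?n" for k
    using coord_le_cube_dist[OF that, of c y] y by (simp add: near_def)
  show free: "free ?n c \<subseteq> free ?n y"
  proof
    fix k assume k: "k \<in> free ?n c"
    then have "k < ?n" by (simp add: free_def)
    moreover have "\<epsilon> \<le> c k \<and> c k \<le> 1 - \<epsilon>" using sep c k unfolding separated_def by blast
    ultimately have "0 < y k" "y k < 1" using close[of k] eps by linarith+
    then show "k \<in> free ?n y" using \<open>k < ?n\<close> by (simp add: free_def)
  qed
  have "c k = y k" if k: "k < ?n" "k \<notin> free ?n y" for k
  proof -
    have "c k = 0 \<or> c k = 1" by (rule not_free[OF cube(1) k(1)]) (use k free in blast)
    moreover have "y k = 0 \<or> y k = 1" by (rule not_free[OF cube(2) k])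
    ultimately show ?thesis using close[OF k(1)] eps by auto
  qed
  then show "c \<in> subcube ?n y (free ?n y)" using cube(1) by (simp add: subcube_def)
qed

lemma near_other_lift:
  assumes sep: "separated x \<epsilon>" and y: "near x r l c y" and r: "r \<le> \<epsilon>/2" and y': "(l', y') \<in> lifts (p (l, y))"
  obtains c' where "near x r l' c' y'" "cube_dist (cdim l') c' y' = cube_dist (cdim l) c y"
proof -
  have near: "near x (\<epsilon>/2) l c y" using y r by (rule near_mono)
  obtain h \<pi> s where h: "transports l y l' y' h \<pi> s" using ex_transport[OF near_lift[OF y] y'] .
  have c: "c \<in> subcube (cdim l) y (free (cdim l) y)" by (rule near_center_in_face[OF sep near])
  have "(l', h c) \<in> lifts (p (l, c))" using transports_lift[OF h y' c] .
  then have lift: "(l', h c) \<in> lifts x" using y by (auto simp: near_def lifts_def)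
  have "y \<in> subcube (cdim l) y (free (cdim l) y)"
    using y by (intro self_in_subcube) (simp add: near_def)
  then have dist: "cube_dist (cdim l') (h c) y' = cube_dist (cdim l) c y"
    using h c unfolding transports_def by metis
  have "near x r l' (h c) y'"
    using lift dist y y' unfolding near_def by (auto simp: lifts_def)
  then show thesis using that dist by blast
qed

text \<open>The isometry that relates \<open>y\<close> and \<open>y'\<close> sends \<open>c\<close> to a lift of \<open>x\<close> close to \<open>y'\<close>. Only \<open>c'\<close>
  is close enough.\<close>

lemma chart_change:
  assumes sep: "separated x \<epsilon>" and y: "near x (\<epsilon>/2) l c y" and y': "near x (\<epsilon>/2) l' c' y'"
    and eq: "p (l, y) = p (l', y')"
  obtains h \<pi> s where "transports l y l' y' h \<pi> s" "h c = c'"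
proof -
  have y'l: "(l', y') \<in> lifts (p (l, y))" using near_lift[OF y'] eq by simp
  obtain h \<pi> s where h: "transports l y l' y' h \<pi> s" using ex_transport[OF near_lift[OF y] y'l] .
  have c: "c \<in> subcube (cdim l) y (free (cdim l) y)" by (rule near_center_in_face[OF sep y])
  have "(l', h c) \<in> lifts (p (l, c))" using transports_lift[OF h y'l c] .
  then have lift: "(l', h c) \<in> lifts x" using y by (auto simp: near_def lifts_def)
  have "y \<in> subcube (cdim l) y (free (cdim l) y)"
    using y by (intro self_in_subcube) (simp add: near_def)
  then have dist: "cube_dist (cdim l') (h c) y' = cube_dist (cdim l) c y"
    using h c unfolding transports_def by metis
  have "h c = c'"
  proof (rule lifts_separated[OF sep lift])
    show "(l', c') \<in> lifts x" using y' by (simp add: near_def)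
    fix k assume k: "k < cdim l'"
    have "cube_dist (cdim l') (h c) c' < \<epsilon>"
      using cube_dist_triangle[of "cdim l'" "h c" c' y'] dist y y'
      by (simp add: near_def cube_dist_commute[of _ y' c'])
    then show "\<bar>h c k - c' k\<bar> < \<epsilon>" using coord_le_cube_dist[OF k, of "h c" c'] by linarith
  qed
  then show thesis using that h by blast
qed

lemma chart_function:
  assumes "\<And>l c y l' c' y'. \<lbrakk>near x r l c y; near x r l' c' y'; p (l, y) = p (l', y')\<rbrakk>
      \<Longrightarrow> \<Phi> l c y = \<Phi> l' c' y'"
  obtains f where "\<And>l c y. near x r l c y \<Longrightarrow> f (p (l, y)) = \<Phi> l c y"
proof -
  define f where "f z = (SOME q. \<exists>l c y. near x r l c y \<and> p (l, y) = z \<and> q = \<Phi> l c y)" for z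
  have "f (p (l, y)) = \<Phi> l c y" if "near x r l c y" for l c y
    unfolding f_def by (rule some_equality) (use that assms in blast)+
  then show thesis by (rule that)
qed

end

section \<open>Geodesics in a CAT(0) space\<close>

lemma geodesic_segment_between:
  assumes S: "geodesic_segment M d a b S" and q: "q \<in> S" and nonneg: "0 \<le> d a b"
  shows "q \<in> M" "d a q + d q b = d a b" "0 \<le> d a q"
proof -
  obtain \<gamma> t where g: "geodesic_path M d a b \<gamma>" "t \<in> {0..d a b}" "q = \<gamma> t"
    using S q unfolding geodesic_segment_def by auto
  then have ends: "\<gamma> 0 = a" "\<gamma> (d a b) = b" and "q \<in> M"
    and dist: "\<And>s t. \<lbrakk>s \<in> {0..d a b}; t \<in> {0..d a b}\<rbrakk> \<Longrightarrow> d (\<gamma> s) (\<gamma> t) = \<bar>s - t\<bar>"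
    unfolding geodesic_path_def by auto
  have "d a q = t" using dist[of 0 t] ends g(2,3) nonneg by simp
  moreover have "d q b = d a b - t" using dist[of t "d a b"] ends g(2,3) nonneg by simp
  ultimately show "q \<in> M" "d a q + d q b = d a b" "0 \<le> d a q" using g(2) \<open>q \<in> M\<close> by simp_all
qed

lemma geodesic_segment_ends:
  assumes "geodesic_segment M d a b S" "0 \<le> d a b"
  shows "a \<in> S" "b \<in> S"
proof -
  obtain \<gamma> where g: "\<gamma> 0 = a" "\<gamma> (d a b) = b" "S = \<gamma> ` {0..d a b}"
    using assms(1) unfolding geodesic_segment_def geodesic_path_def by blast
  have "\<gamma> 0 \<in> S" "\<gamma> (d a b) \<in> S" unfolding g(3) using assms(2) by simp_all
  then show "a \<in> S" "b \<in> S" using g by simp_all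
qed

lemma CAT0_inequality:
  assumes "CAT0_space M d" "a \<in> M" "b \<in> M" "c \<in> M"
    and "geodesic_segment M d a b S1" "geodesic_segment M d b c S2" "geodesic_segment M d c a S3"
    and "dist A B = d a b" "dist B C = d b c" "dist C A = d c a"
    and "comparison_point d a S1 A B x P" "comparison_point d c S3 C A y Q"
  shows "d x y \<le> dist P Q"
  using assms unfolding CAT0_space_def Let_def by blast

text \<open>The comparison triangle of \<open>a\<close>, \<open>b\<close>, \<open>q'\<close> is degenerate, and its vertex for \<open>q'\<close> is also the
  comparison point of \<open>q\<close> on the side from \<open>a\<close> to \<open>b\<close>.\<close>

lemma CAT0_unique_between:
  assumes cat: "CAT0_space M d" and ab: "a \<in> M" "b \<in> M" and S: "geodesic_segment M d a b S"
    and q: "q \<in> S" and q': "q' \<in> M" "d a q' = d a q" "d q' b = d q b"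
  shows "q' = q"
proof -
  interpret Metric_space M d using cat by (simp add: CAT0_space_def)
  have qM: "q \<in> M" "d a q + d q b = d a b" using geodesic_segment_between[OF S q] by auto
  obtain S2 S3 where S23: "geodesic_segment M d b q' S2" "geodesic_segment M d q' a S3"
    using cat ab q'(1) unfolding CAT0_space_def by meson
  define e :: "real^2" where "e = axis 1 1"
  have norm_e: "norm e = 1" by (simp add: e_def)
  have dist_e: "dist (s *\<^sub>R e) (t *\<^sub>R e) = \<bar>s - t\<bar>" for s t
    by (simp add: e_def dist_norm flip: scaleR_left_diff_distrib)
  define A B C where "A = 0 *\<^sub>R e" and "B = d a b *\<^sub>R e" and "C = d a q *\<^sub>R e"
  have le: "0 \<le> d a q" "d a q \<le> d a b" using qM(2) nonneg[of q b] by (simp, linarith)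
  have "C \<in> closed_segment A B"
  proof (cases "d a b = 0")
    case True
    then have "d a q = 0" using le by linarith
    then show ?thesis by (simp add: A_def C_def)
  next
    case False
    then have "C = (1 - d a q / d a b) *\<^sub>R A + (d a q / d a b) *\<^sub>R B"
      by (simp add: A_def B_def C_def)
    moreover have "0 < d a b" using False le by linarith
    ultimately show ?thesis
      using le unfolding closed_segment_def
      by (intro CollectI exI[of _ "d a q / d a b"] conjI) (auto simp: divide_le_eq)
  qed
  then have "comparison_point d a S A B q C"
    using q by (simp add: comparison_point_def A_def C_def norm_e)
  moreover have "comparison_point d q' S3 C A q' C"
    using geodesic_segment_ends(1)[OF S23(2)] q'(1) by (simp add: comparison_point_def)
  moreover have "dist A B = d a b" "dist C A = d q' a" "dist B C = d b q'"
    using qM(2) q' commute[of q' a] commute[of b q']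
    by (simp_all only: A_def B_def C_def dist_e) (use le in linarith)+
  ultimately have "d q q' \<le> dist C C"
    using CAT0_inequality[OF cat ab q'(1) S S23] by blast
  then show ?thesis using qM(1) q'(1) nonneg[of q q'] zero by simp
qed

lemma CAT0_unique_between':
  assumes cat: "CAT0_space M d" and ab: "a \<in> M" "b \<in> M"
    and q: "q \<in> M" "d a q + d q b = d a b" and q': "q' \<in> M" "d a q' = d a q" "d q' b = d q b"
  shows "q' = q"
proof -
  interpret Metric_space M d using cat by (simp add: CAT0_space_def)
  obtain \<gamma> where g: "geodesic_path M d a b \<gamma>"
    using cat ab unfolding CAT0_space_def geodesic_segment_def by blast
  let ?S = "\<gamma> ` {0..d a b}" and ?q = "\<gamma> (d a q)"
  have S: "geodesic_segment M d a b ?S" unfolding geodesic_segment_def by (intro exI[of _ \<gamma>] conjI g refl)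
  have "d a q \<le> d a b" using q(2) nonneg[of q b] by linarith
  then have t: "d a q \<in> {0..d a b}" by simp
  have ends: "\<gamma> 0 = a" "\<gamma> (d a b) = b"
    and dist: "\<And>s t. \<lbrakk>s \<in> {0..d a b}; t \<in> {0..d a b}\<rbrakk> \<Longrightarrow> d (\<gamma> s) (\<gamma> t) = \<bar>s - t\<bar>"
    using g unfolding geodesic_path_def by auto
  have "d a ?q = d a q" using dist[of 0 "d a q"] ends t by simp
  moreover have "d ?q b = d q b" using dist[of "d a q" "d a b"] ends t q(2) by simp
  moreover have S_q: "?q \<in> ?S" using t by (rule imageI)
  ultimately have eq: "z = ?q" if "z \<in> M" "d a z = d a q" "d z b = d q b" for z
    using CAT0_unique_between[OF cat ab S S_q, of z] that by simp
  have "q = ?q" by (rule eq[OF q(1)]) simp_all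
  moreover have "q' = ?q" by (rule eq[OF q'])
  ultimately show ?thesis by metis
qed

lemma ex_comparison_triangle:
  fixes a b c :: real
  assumes "0 < c" "0 \<le> a" "0 \<le> b" "a \<le> b + c" "b \<le> a + c" "c \<le> a + b"
  obtains A B C :: "real^2" where "dist A B = c" "dist B C = a" "dist C A = b"
proof -
  define V :: "real \<Rightarrow> real \<Rightarrow> real^2" where "V u v = (\<chi> i. if i = 1 then u else v)" for u v
  have dist_V: "dist (V u v) (V u' v') = sqrt ((u - u')\<^sup>2 + (v - v')\<^sup>2)" for u v u' v'
    by (simp add: V_def dist_vec_def L2_set_def sum_2 dist_real_def)
  define u where "u = (b\<^sup>2 + c\<^sup>2 - a\<^sup>2) / (2 * c)"
  define v where "v = sqrt (b\<^sup>2 - u\<^sup>2)"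
  have cu: "2 * c * u = b\<^sup>2 + c\<^sup>2 - a\<^sup>2" using assms(1) by (simp add: u_def)
  have "(b - c)\<^sup>2 \<le> a\<^sup>2" by (rule power2_le_iff_abs_le[THEN iffD2]) (use assms in auto)
  then have "2 * c * u \<le> 2 * c * b" unfolding cu by (simp add: power2_eq_square algebra_simps)
  then have "u \<le> b" using assms(1) by simp
  have "a\<^sup>2 \<le> (b + c)\<^sup>2" by (rule power_mono) (use assms in auto)
  then have "2 * c * (- b) \<le> 2 * c * u" unfolding cu by (simp add: power2_eq_square algebra_simps)
  then have "- b \<le> u" using assms(1) by (simp only: mult_le_cancel_left_pos)
  with \<open>u \<le> b\<close> have "u\<^sup>2 \<le> b\<^sup>2" by (simp add: abs_le_square_iff flip: abs_le_square_iff)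
  then have v: "v\<^sup>2 = b\<^sup>2 - u\<^sup>2" by (simp add: v_def)
  show thesis
  proof (rule that)
    show "dist (V 0 0) (V c 0) = c" using assms(1) by (simp add: dist_V)
    have "(c - u)\<^sup>2 + (0 - v)\<^sup>2 = a\<^sup>2" using v cu by (simp add: power2_eq_square algebra_simps)
    then show "dist (V c 0) (V u v) = a" using assms(2) by (simp add: dist_V)
    have "(u - 0)\<^sup>2 + (v - 0)\<^sup>2 = b\<^sup>2" using v by simp
    then show "dist (V u v) (V 0 0) = b" using assms(3) by (simp add: dist_V)
  qed
qed

text \<open>Compare with the triangle \<open>A B C\<close> for \<open>a\<close>, \<open>b\<close>, \<open>x\<close>: the Euclidean disc around \<open>C\<close> is
  convex.\<close>

lemma CAT0_ball_convex:
  assumes cat: "CAT0_space M d" and xab: "x \<in> M" "a \<in> M" "b \<in> M"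
    and S: "geodesic_segment M d a b S" and q: "q \<in> S" and r: "d x a < r" "d x b < r"
  shows "d x q < r"
proof -
  interpret Metric_space M d using cat by (simp add: CAT0_space_def)
  have qM: "q \<in> M" "d a q + d q b = d a b" using geodesic_segment_between[OF S q] by auto
  show ?thesis
  proof (cases "d a b = 0")
    case True
    then have "d a q = 0" using qM(2) nonneg[of a q] nonneg[of q b] by linarith
    then show ?thesis using qM(1) xab zero r by auto
  next
    case False
    then have pos: "0 < d a b" using nonneg[of a b] by linarith
    obtain A B C :: "real^2" where ABC: "dist A B = d a b" "dist B C = d b x" "dist C A = d x a"
      by (rule ex_comparison_triangle[OF pos, of "d b x" "d x a"])
        (use triangle[of b a x] triangle[of x b a] triangle[of a x b] xab in \<open>simp_all add: commute\<close>)
    define t where "t = d a q / d a b"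
    define Q where "Q = (1 - t) *\<^sub>R A + t *\<^sub>R B"
    have "d a q \<le> d a b" using qM(2) nonneg[of q b] by linarith
    then have t: "0 \<le> t" "t \<le> 1" using pos by (auto simp: t_def)
    then have Q: "Q \<in> closed_segment A B" by (auto simp: Q_def closed_segment_def)
    have "dist A Q = d a q"
    proof -
      have "A - Q = t *\<^sub>R (A - B)" by (simp add: Q_def algebra_simps)
      then have "dist A Q = t * dist A B" using t by (simp add: dist_norm)
      then show ?thesis using ABC(1) pos by (simp add: t_def)
    qed
    then have comp_q: "comparison_point d a S A B q Q" using q Q by (simp add: comparison_point_def)
    obtain S2 S3 where S23: "geodesic_segment M d b x S2" "geodesic_segment M d x a S3"
      using cat xab unfolding CAT0_space_def by meson
    have "comparison_point d x S3 C A x C"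
      using geodesic_segment_ends(1)[OF S23(2)] xab by (simp add: comparison_point_def)
    then have "d q x \<le> dist Q C"
      using CAT0_inequality[OF cat xab(2,3,1) S S23 ABC comp_q] by blast
    moreover have "closed_segment A B \<subseteq> ball C r"
      by (rule closed_segment_subset) (use ABC r in \<open>auto simp: dist_commute commute\<close>)
    ultimately show ?thesis using Q by (auto simp: commute dist_commute)
  qed
qed

lemma (in Metric_space) short_path_is_geodesic:
  assumes M: "\<And>t. t \<in> {0..D} \<Longrightarrow> \<gamma> t \<in> M"
    and short: "\<And>s t. \<lbrakk>s \<in> {0..D}; t \<in> {0..D}\<rbrakk> \<Longrightarrow> d (\<gamma> s) (\<gamma> t) \<le> \<bar>s - t\<bar>"
    and ends: "d (\<gamma> 0) (\<gamma> D) = D"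
  shows "geodesic_path M d (\<gamma> 0) (\<gamma> D) \<gamma>"
proof -
  have D: "0 \<le> D" using ends nonneg by metis
  have *: "d (\<gamma> s) (\<gamma> t) = t - s" if "0 \<le> s" "s \<le> t" "t \<le> D" for s t
  proof -
    have "D \<le> d (\<gamma> 0) (\<gamma> s) + d (\<gamma> s) (\<gamma> t) + d (\<gamma> t) (\<gamma> D)"
      using triangle[of "\<gamma> 0" "\<gamma> s" "\<gamma> D"] triangle[of "\<gamma> s" "\<gamma> t" "\<gamma> D"] M that D ends by force
    moreover have "d (\<gamma> 0) (\<gamma> s) \<le> s" "d (\<gamma> t) (\<gamma> D) \<le> D - t" "d (\<gamma> s) (\<gamma> t) \<le> t - s"
      using short[of 0 s] short[of t D] short[of s t] that D by auto
    ultimately show ?thesis by linarith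
  qed
  have "d (\<gamma> s) (\<gamma> t) = \<bar>s - t\<bar>" if "s \<in> {0..D}" "t \<in> {0..D}" for s t
    using *[of s t] *[of t s] that commute[of "\<gamma> s" "\<gamma> t"] by (cases "s \<le> t") auto
  then show ?thesis using M ends unfolding geodesic_path_def by auto
qed

section \<open>The length metric near a point\<close>

context cubed_complex
begin

lemma broken_path_nonneg: "broken_path a b r \<Longrightarrow> 0 \<le> r"
  by (induction rule: broken_path.induct) auto

lemma length_dist_le:
  assumes "broken_path a b r"
  shows "length_dist a b \<le> r"
proof -
  have "length_edist a b \<le> ennreal r"
    unfolding length_edist_def by (rule Inf_lower) (use assms in blast)
  then show ?thesis
    unfolding length_dist_def using broken_path_nonneg[OF assms] by (intro enn2real_leI)
qed

lemma ex_broken_path: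
  assumes fin: "length_edist a b < \<infinity>" and r: "length_dist a b < r"
  obtains r' where "r' < r" "broken_path a b r'"
proof -
  have "0 < r" using r enn2real_nonneg unfolding length_dist_def by (metis le_less_trans)
  have "length_edist a b = ennreal (length_dist a b)"
    using fin unfolding length_dist_def by (simp add: less_top)
  also have "\<dots> < ennreal r" using r \<open>0 < r\<close> by (simp add: ennreal_lessI)
  finally obtain r' where "broken_path a b r'" "ennreal r' < ennreal r"
    unfolding length_edist_def Inf_less_iff by blast
  then show thesis using that broken_path_nonneg ennreal_less_iff by blast
qed

lemma length_dist_cube_le:
  assumes "l \<in> \<Lambda>" "y \<in> unit_cube (cdim l)" "z \<in> unit_cube (cdim l)"
  shows "length_dist (p (l, y)) (p (l, z)) \<le> cube_dist (cdim l) y z"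
proof -
  have "p (l, z) \<in> points" using assms by (auto simp: points_def)
  then have "broken_path (p (l, y)) (p (l, z)) (cube_dist (cdim l) y z + 0)"
    by (intro segment trivial assms)
  then show ?thesis using length_dist_le by simp
qed

text \<open>Induction along a broken path that is too short to leave the neighbourhood of \<open>x\<close>. Here \<open>Q t
  z\<close> is a bound at \<open>z\<close> that may depend on the length \<open>t\<close> travelled so far. Each segment stays in
  one cube and can be described with one centre \<open>c\<close>, because the description at its starting point
  can be moved to the cube of the segment.\<close>

lemma path_in_chart:
  assumes sep: "separated x \<epsilon>" and \<rho>: "\<rho> \<le> \<epsilon>/2"
    and step: "\<And>l c y y' t. \<lbrakk>near x (\<epsilon>/2) l c y; near x (\<epsilon>/2) l c y'; Q t (p (l, y))\<rbrakk>
        \<Longrightarrow> Q (t + cube_dist (cdim l) y y') (p (l, y'))"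
  shows "\<lbrakk>broken_path a b r; near x (\<rho> - r) l c y; p (l, y) = a; Q t a\<rbrakk>
    \<Longrightarrow> Q (t + r) b \<and> (\<exists>l c y. near x \<rho> l c y \<and> p (l, y) = b)"
proof (induction arbitrary: l c y t rule: broken_path.induct)
  case (trivial a)
  then show ?case by auto
next
  case (segment l u z b r l0 c0 y0 t)
  let ?D = "cube_dist (cdim l) u z"
  have r: "0 \<le> r" using segment.hyps broken_path_nonneg by blast
  have "(l, u) \<in> lifts (p (l0, y0))" using segment.hyps segment.prems by (simp add: lifts_def)
  then obtain c where c: "near x (\<rho> - (?D + r)) l c u"
    using near_other_lift[OF sep segment.prems(1)] \<rho> r cube_dist_nonneg[of "cdim l" u z]
    by (smt (verit))
  have z: "near x (\<rho> - r) l c z"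
    using c segment.hyps(3) cube_dist_triangle[of "cdim l" c z u] by (auto simp: near_def)
  have "near x (\<epsilon>/2) l c u" "near x (\<epsilon>/2) l c z"
    by (rule near_mono[OF c] near_mono[OF z], use \<rho> r cube_dist_nonneg[of "cdim l" u z] in linarith)+
  then have "Q (t + ?D) (p (l, z))" using step segment.prems(3) by blast
  from segment.IH[OF z refl this] show ?case by (simp add: add.assoc)
qed

end

locale CAT0_cubed_complex = cubed_complex +
  assumes CAT0: CAT0
begin

lemma CAT0_points: "CAT0_space points length_dist"
  using CAT0 by (simp add: CAT0_def)

sublocale Metric_space points length_dist
  using CAT0_points by (simp add: CAT0_space_def)

lemma finite_edist: "\<lbrakk>a \<in> points; b \<in> points\<rbrakk> \<Longrightarrow> length_edist a b < \<infinity>"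
  using CAT0 by (simp add: CAT0_def)

lemma near_points: "near x r l c y \<Longrightarrow> p (l, y) \<in> points"
  by (auto simp: near_def lifts_def points_def)

lemma dist_imp_near:
  assumes sep: "separated x \<epsilon>" and x: "x \<in> points" and z: "z \<in> points" "length_dist x z < r" and r: "r \<le> \<epsilon>/2"
  obtains l c y where "near x r l c y" "p (l, y) = z"
proof -
  obtain r' where r': "r' < r" "broken_path x z r'" using ex_broken_path[OF finite_edist[OF x z(1)] z(2)] .
  obtain l c where c: "(l, c) \<in> lifts x" using x points_iff_lift by blast
  then have "near x (r - r') l c c" "p (l, c) = x" using r' by (auto simp: near_def lifts_def)
  then show thesis
    using path_in_chart[OF sep r, of "\<lambda>_ _. True"] r'(2) that by blast
qed

text \<open>Broken paths only approximate the distance; therefore \<open>Q\<close> is obtained for some length below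
  any \<open>r > length_dist a b\<close>.\<close>

lemma chart_induct:
  assumes sep: "separated x \<epsilon>" and pts: "x \<in> points" "a \<in> points" "b \<in> points"
    and close: "length_dist x a + length_dist a b < \<epsilon>/2"
    and step: "\<And>l c y y' t. \<lbrakk>near x (\<epsilon>/2) l c y; near x (\<epsilon>/2) l c y'; Q t (p (l, y))\<rbrakk>
        \<Longrightarrow> Q (t + cube_dist (cdim l) y y') (p (l, y'))"
    and start: "Q 0 a" and r: "length_dist a b < r"
  obtains r' where "r' < r" "Q r' b"
proof -
  define e where "e = min (r - length_dist a b) ((\<epsilon>/2 - length_dist x a - length_dist a b) / 2)"
  have e: "0 < e" "e \<le> r - length_dist a b" "length_dist x a + e + (length_dist a b + e) \<le> \<epsilon>/2"
    using r close unfolding e_def by (auto simp: min_def field_simps)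
  obtain r' where r': "r' < length_dist a b + e" "broken_path a b r'"
    using ex_broken_path[OF finite_edist[OF pts(2,3)], of "length_dist a b + e"] e by auto
  obtain l c y where y: "near x (length_dist x a + e) l c y" "p (l, y) = a"
    by (rule dist_imp_near[OF sep pts(1,2), of "length_dist x a + e"])
      (use e nonneg[of a b] in \<open>linarith+\<close>)
  have "near x (\<epsilon>/2 - r') l c y" by (rule near_mono[OF y(1)]) (use e r' in auto)
  then have "Q (0 + r') b"
    using path_in_chart[where Q = Q, OF sep order_refl _ r'(2) _ y(2) start] step by blast
  then show thesis using that[of r'] e r' by auto
qed

lemma chart_lipschitz:
  assumes sep: "separated x \<epsilon>" and pts: "x \<in> points" "a \<in> points" "b \<in> points"
    and close: "length_dist x a + length_dist a b < \<epsilon>/2"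
    and step: "\<And>l c y y'. \<lbrakk>near x (\<epsilon>/2) l c y; near x (\<epsilon>/2) l c y'\<rbrakk>
        \<Longrightarrow> g (p (l, y')) \<le> g (p (l, y)) + cube_dist (cdim l) y y'"
  shows "g b - g a \<le> length_dist a b"
proof (rule ccontr)
  assume "\<not> g b - g a \<le> length_dist a b"
  then have less: "length_dist a b < g b - g a" by simp
  obtain r' where "r' < g b - g a" "g b \<le> g a + r'"
  proof (rule chart_induct[OF sep pts close _ _ less, of "\<lambda>t z. g z \<le> g a + t"])
    fix l c y y' t
    assume "near x (\<epsilon>/2) l c y" "near x (\<epsilon>/2) l c y'" "g (p (l, y)) \<le> g a + t"
    then show "g (p (l, y')) \<le> g a + (t + cube_dist (cdim l) y y')" using step[of l c y y'] by simp
  qed auto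
  then show False by simp
qed

end

section \<open>Retracting a neighbourhood onto a subcomplex\<close>

text \<open>A point in direction \<open>k\<close> from \<open>c\<close>; whether \<open>p\<close> maps it into \<open>W\<close> tells whether this direction
  leads out of \<open>W\<close>, and at a vertex its image names the edge together with the end at which it
  starts. The new coordinate is halfway to 1/2, and not, say, 1/2 itself, in order to distinguish
  the two ends of an edge. This choice is compatible with reflections.\<close>

definition nudge :: "(nat \<Rightarrow> real) \<Rightarrow> nat \<Rightarrow> nat \<Rightarrow> real" where
  "nudge c k = c(k := (c k + 1/2) / 2)"

lemma nudge_cube: "\<lbrakk>c \<in> unit_cube n; k < n\<rbrakk> \<Longrightarrow> nudge c k \<in> unit_cube n"
  by (auto simp: unit_cube_iff nudge_def extensional_def)

lemma nudge_in_subcube: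
  assumes "c \<in> subcube n y A" "k \<in> A" "k < n"
  shows "nudge c k \<in> subcube n y A"
  using assms nudge_cube[of c n k] by (auto simp: subcube_def nudge_def)

lemma free_nudge:
  assumes "c \<in> unit_cube n" "k < n"
  shows "free n (nudge c k) = insert k (free n c)"
proof -
  have "0 \<le> c k" "c k \<le> 1" using assms by (auto simp: unit_cube_iff)
  then show ?thesis using assms(2) by (auto simp: free_def nudge_def)
qed

lemma flip_nudge: "flip s ((t + 1/2) / 2) = (flip s t + 1/2) / 2"
  by (simp add: flip_def field_simps)

context cubed_complex
begin

lemma transports_nudge:
  assumes h: "transports l y l' y' h \<pi> s" and y': "(l', y') \<in> lifts q"
    and c: "c \<in> subcube (cdim l) y (free (cdim l) y)" and k: "k \<in> free (cdim l') y'"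
  shows "h (nudge c (\<pi> k)) = nudge (h c) k" "p (l, nudge c (\<pi> k)) = p (l', nudge (h c) k)"
proof -
  let ?n' = "cdim l'"
  have \<pi>k: "\<pi> k \<in> free (cdim l) y" "\<pi> k < cdim l" "k < ?n'"
    using transports_perm[OF h k] k free_subset by auto
  have nc: "nudge c (\<pi> k) \<in> subcube (cdim l) y (free (cdim l) y)"
    by (rule nudge_in_subcube[OF c \<pi>k(1,2)])
  have hc: "h c \<in> unit_cube ?n'" "h (nudge c (\<pi> k)) \<in> unit_cube ?n'"
    using h c nc subcube_subset unfolding transports_def by blast+
  show eq: "h (nudge c (\<pi> k)) = nudge (h c) k"
  proof (rule unit_cube_eqI[OF hc(2) nudge_cube[OF hc(1) \<pi>k(3)]])
    fix j assume j: "j < ?n'"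
    show "h (nudge c (\<pi> k)) j = nudge (h c) k j"
    proof (cases "j \<in> free ?n' y'")
      case True
      have "h (nudge c (\<pi> k)) j = flip (s j) (nudge c (\<pi> k) (\<pi> j))"
        by (rule transports_coord[OF h nc True])
      moreover have "\<pi> j = \<pi> k \<longleftrightarrow> j = k"
        using h True k unfolding transports_def bij_betw_def inj_on_def by blast
      ultimately show ?thesis
        using transports_coord[OF h c True] by (auto simp: nudge_def flip_nudge)
    next
      case False
      then have "j \<noteq> k" using k by blast
      then show ?thesis
        using transports_fixed[OF h nc j False] transports_fixed[OF h c j False] by (simp add: nudge_def)
    qed
  qed
  show "p (l, nudge c (\<pi> k)) = p (l', nudge (h c) k)"
    using h nc eq unfolding transports_def by metis
qed

text \<open>Since \<open>p\<close> maps the nudges in the free directions of \<open>c\<close> into any subcomplex that contains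
  the point under \<open>c\<close>, only directions transversal to the smallest face of \<open>c\<close> can be reset.\<close>

definition retract :: "'x set \<Rightarrow> 'i \<Rightarrow> (nat \<Rightarrow> real) \<Rightarrow> (nat \<Rightarrow> real) \<Rightarrow> nat \<Rightarrow> real" where
  "retract W l c y = (\<lambda>k\<in>{..<cdim l}. if p (l, nudge c k) \<in> W then y k else c k)"

lemma retract_cube:
  "\<lbrakk>c \<in> unit_cube (cdim l); y \<in> unit_cube (cdim l)\<rbrakk> \<Longrightarrow> retract W l c y \<in> unit_cube (cdim l)"
  by (auto simp: retract_def unit_cube_iff)

lemma retract_compatible:
  assumes sep: "separated x \<epsilon>" and y: "near x (\<epsilon>/2) l c y" and y': "near x (\<epsilon>/2) l' c' y'"
    and eq: "p (l, y) = p (l', y')"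
  shows "p (l, retract W l c y) = p (l', retract W l' c' y')"
proof -
  let ?F = "subcube (cdim l) y (free (cdim l) y)"
  obtain h \<pi> s where h: "transports l y l' y' h \<pi> s" "h c = c'" using chart_change[OF sep y y' eq] .
  have cF: "c \<in> ?F" by (rule near_center_in_face[OF sep y])
  have c'F: "c' \<in> subcube (cdim l') y' (free (cdim l') y')" by (rule near_center_in_face[OF sep y'])
  have cubes: "c \<in> unit_cube (cdim l)" "y \<in> unit_cube (cdim l)" "c' \<in> unit_cube (cdim l')" "y' \<in> unit_cube (cdim l')"
    using y y' by (auto simp: near_def lifts_def)
  have yF: "y \<in> ?F" by (rule self_in_subcube[OF cubes(2)])
  have hy: "h y = y'" using h unfolding transports_def by blast
  have rF: "retract W l c y \<in> ?F"
    using retract_cube[OF cubes(1,2)] cF by (auto simp: subcube_def retract_def)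
  have "h (retract W l c y) = retract W l' c' y'"
  proof (rule unit_cube_eqI[OF _ retract_cube[OF cubes(3,4)]])
    show "h (retract W l c y) \<in> unit_cube (cdim l')"
      using h rF subcube_subset unfolding transports_def by blast
    fix k assume k: "k < cdim l'"
    show "h (retract W l c y) k = retract W l' c' y' k"
    proof (cases "k \<in> free (cdim l') y'")
      case True
      have "\<pi> k < cdim l" using transports_perm[OF h(1) True] free_subset by auto
      moreover have "p (l, nudge c (\<pi> k)) = p (l', nudge c' k)"
        using transports_nudge(2)[OF h(1) near_lift[OF y'] cF True] h(2) by simp
      moreover have "y' k = flip (s k) (y (\<pi> k))" "c' k = flip (s k) (c (\<pi> k))"
        using transports_coord[OF h(1) yF True] transports_coord[OF h(1) cF True] hy h(2) by simp_all
      ultimately show ?thesis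
        using transports_coord[OF h(1) rF True] k by (simp add: retract_def)
    next
      case False
      then have "c' k = y' k" using c'F k by (simp add: subcube_def)
      then show ?thesis using transports_fixed[OF h(1) rF k False] k by (simp add: retract_def)
    qed
  qed
  then show ?thesis using h(1) rF unfolding transports_def by metis
qed

text \<open>A nudge in a free direction of \<open>y\<close> lies in the smallest face of \<open>y\<close>, which \<open>p\<close> maps into
  \<open>W\<close>.\<close>

lemma retract_id:
  assumes sep: "separated x \<epsilon>" and W: "subcomplex W" and y: "near x (\<epsilon>/2) l c y" and yW: "p (l, y) \<in> W"
  shows "retract W l c y = y"
proof (rule unit_cube_eqI)
  let ?n = "cdim l"
  show cy: "retract W l c y \<in> unit_cube ?n" "y \<in> unit_cube ?n"
    using y retract_cube by (auto simp: near_def lifts_def)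
  fix k assume k: "k < ?n"
  have cF: "c \<in> subcube ?n y (free ?n y)" by (rule near_center_in_face[OF sep y])
  show "retract W l c y k = y k"
  proof (cases "k \<in> free ?n y")
    case True
    have "nudge c k \<in> subcube ?n y (free ?n y)" by (rule nudge_in_subcube[OF cF True k])
    then have "p (l, nudge c k) \<in> W"
      using subcomplex_contains_face[OF W near_lift[OF y] yW] by blast
    then show ?thesis using k by (simp add: retract_def)
  next
    case False
    then have "c k = y k" using cF k by (simp add: subcube_def)
    then show ?thesis using k by (simp add: retract_def)
  qed
qed

text \<open>An edge at the vertex \<open>w\<close> lies in a subcomplex iff the nudge along this edge does.\<close>

definition spans_faces :: "'x set \<Rightarrow> 'x \<Rightarrow> bool" where
  "spans_faces W v \<longleftrightarrow> (\<forall>(l, w)\<in>lifts v. w \<in> cube_vertices (cdim l) \<longrightarrow>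
     (\<forall>A\<subseteq>{..<cdim l}. (\<forall>a\<in>A. p (l, nudge w a) \<in> W) \<longrightarrow> (\<forall>y\<in>subcube (cdim l) w A. p (l, y) \<in> W)))"

text \<open>The centre \<open>c\<close> need not be a vertex, so the condition on faces is applied at a vertex \<open>w\<close> of
  the smallest face of \<open>c\<close>. The retracted point lies in the face at \<open>w\<close> spanned by the directions
  that do not leave \<open>W\<close>.\<close>

lemma retract_in_subcomplex:
  assumes W: "subcomplex W" and x: "x \<in> W" and span: "\<And>v. v \<in> vertices \<inter> W \<Longrightarrow> spans_faces W v"
    and c: "(l, c) \<in> lifts x" and y: "y \<in> unit_cube (cdim l)"
  shows "p (l, retract W l c y) \<in> W"
proof -
  let ?n = "cdim l"
  have l: "l \<in> \<Lambda>" "c \<in> unit_cube ?n" using c by (auto simp: lifts_def)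
  \<comment> \<open>Rounding the free coordinates gives a vertex that shares its faces in \<open>W\<close> with \<open>c\<close>.\<close>
  define w where "w = (\<lambda>k\<in>{..<?n}. if k \<in> free ?n c then 0 else c k)"
  define A where "A = {k. k < ?n \<and> p (l, nudge c k) \<in> W}"
  have w: "w \<in> cube_vertices ?n" using not_free[OF l(2)] by (auto simp: w_def cube_vertices_iff)
  have wF: "w \<in> subcube ?n c (free ?n c)"
    using vertex_in_cube[OF w] by (auto simp: subcube_def w_def)
  have vW: "p (l, w) \<in> W" by (rule subcomplex_contains_face[OF W c x wF order_refl])
  have v: "p (l, w) \<in> vertices" using l(1) w by (auto simp: vertices_def)
  have "\<forall>y\<in>subcube ?n w A. p (l, y) \<in> W"
  proof -
    have "p (l, nudge w a) \<in> W" if a: "a \<in> A" for a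
    proof -
      have an: "a < ?n" "p (l, nudge c a) \<in> W" using a by (auto simp: A_def)
      have "(l, nudge c a) \<in> lifts (p (l, nudge c a))" by (rule lift_self[OF l(1) nudge_cube[OF l(2) an(1)]])
      moreover have "nudge w a \<in> subcube ?n (nudge c a) (insert a (free ?n c))"
        using nudge_cube[OF vertex_in_cube[OF w] an(1)] wF by (auto simp: subcube_def nudge_def)
      ultimately show ?thesis
        using subcomplex_contains_face[OF W _ an(2)] free_nudge[OF l(2) an(1)] by blast
    qed
    moreover have "A \<subseteq> {..<?n}" by (auto simp: A_def)
    moreover have "(l, w) \<in> lifts (p (l, w))" by (rule lift_self[OF l(1) vertex_in_cube[OF w]])
    ultimately show ?thesis using span[of "p (l, w)"] v vW w unfolding spans_faces_def by blast
  qed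
  moreover have "retract W l c y \<in> subcube ?n w A"
  proof -
    have "retract W l c y k = w k" if k: "k < ?n" "k \<notin> A" for k
    proof -
      have "k \<notin> free ?n c"
      proof
        assume kf: "k \<in> free ?n c"
        have "nudge c k \<in> subcube ?n c (free ?n c)"
          by (rule nudge_in_subcube[OF self_in_subcube[OF l(2)] kf k(1)])
        then have "p (l, nudge c k) \<in> W" using subcomplex_contains_face[OF W c x] by blast
        then show False using k by (simp add: A_def)
      qed
      then show ?thesis using k by (simp add: retract_def w_def A_def)
    qed
    then show ?thesis using retract_cube[OF l(2) y] by (simp add: subcube_def)
  qed
  ultimately show ?thesis by blast
qed

lemma subcomplex_subset_points:
  assumes "subcomplex W" shows "W \<subseteq> points"
proof
  fix z assume "z \<in> W"
  then obtain l F where "l \<in> \<Lambda>" "F \<in> cube_faces (cdim l)" "z \<in> p ` ({l} \<times> F)"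
    using assms unfolding subcomplex_def closed_cells_def by blast
  moreover have "F \<subseteq> unit_cube (cdim l)"
    using calculation(2) by (auto simp: cube_faces_def cube_face_def)
  ultimately show "z \<in> points" unfolding points_def by blast
qed

end

context CAT0_cubed_complex
begin

text \<open>For \<open>q\<close> on the geodesic between points \<open>a\<close> and \<open>b\<close> of \<open>W\<close> near \<open>x\<close>, the retracted point is
  no farther from \<open>a\<close> and \<open>b\<close> than \<open>q\<close>, hence equal to \<open>q\<close>.\<close>

lemma locally_convex_if_spans_faces:
  assumes W: "subcomplex W" and span: "\<And>v. v \<in> vertices \<inter> W \<Longrightarrow> spans_faces W v"
  shows "locally_convex points length_dist W"
  unfolding locally_convex_def
proof (intro conjI ballI)
  show sub: "W \<subseteq> points" by (rule subcomplex_subset_points[OF W])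
  fix x assume x: "x \<in> W"
  then have xp: "x \<in> points" using sub by blast
  obtain \<epsilon> where sep: "separated x \<epsilon>" using ex_separated[OF xp] .
  then have eps: "0 < \<epsilon>" by (simp add: separated_def)
  obtain f where f: "\<And>l c y. near x (\<epsilon>/2) l c y \<Longrightarrow> f (p (l, y)) = p (l, retract W l c y)"
    using chart_function[of x "\<epsilon>/2" "\<lambda>l c y. p (l, retract W l c y)"] retract_compatible[OF sep] by blast
  have near_rep: "\<exists>l c y. near x (\<epsilon>/2) l c y \<and> p (l, y) = z" if "z \<in> points" "length_dist x z < \<epsilon>/2" for z
    using dist_imp_near[OF sep xp that order_refl] by blast
  have f_W: "f z \<in> W" if z: "z \<in> points" "length_dist x z < \<epsilon>/2" for z
  proof -
    obtain l c y where y: "near x (\<epsilon>/2) l c y" "p (l, y) = z" using near_rep[OF z] by blast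
    then have "p (l, retract W l c y) \<in> W"
      using retract_in_subcomplex[OF W x span] by (auto simp: near_def)
    then show ?thesis using f[OF y(1)] y(2) by simp
  qed
  have f_id: "f z = z" if z: "z \<in> W" "length_dist x z < \<epsilon>/2" for z
  proof -
    obtain l c y where y: "near x (\<epsilon>/2) l c y" "p (l, y) = z" using near_rep z sub by blast
    then show ?thesis using f[OF y(1)] retract_id[OF sep W y(1)] z(1) by simp
  qed
  have f_short: "length_dist (f a) (f b) \<le> length_dist a b"
    if ab: "a \<in> points" "b \<in> points" and close: "length_dist x a + length_dist a b < \<epsilon>/2" for a b
  proof -
    have fa: "f a \<in> points" using f_W[OF ab(1)] close nonneg[of a b] sub by force
    have "length_dist (f a) (f b) - length_dist (f a) (f a) \<le> length_dist a b"
    proof (rule chart_lipschitz[OF sep xp ab close])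
      fix l c y y' assume y: "near x (\<epsilon>/2) l c y" and y': "near x (\<epsilon>/2) l c y'"
      have cubes: "l \<in> \<Lambda>" "retract W l c y \<in> unit_cube (cdim l)" "retract W l c y' \<in> unit_cube (cdim l)"
        using y y' by (auto simp: near_def lifts_def intro: retract_cube)
      have "length_dist (f (p (l, y))) (f (p (l, y'))) \<le> cube_dist (cdim l) (retract W l c y) (retract W l c y')"
        unfolding f[OF y] f[OF y'] by (rule length_dist_cube_le[OF cubes])
      also have "\<dots> \<le> cube_dist (cdim l) y y'"
        by (rule cube_dist_mono) (simp add: retract_def)
      finally have "length_dist (f (p (l, y))) (f (p (l, y'))) \<le> cube_dist (cdim l) y y'" .
      moreover have "f (p (l, y)) \<in> points" "f (p (l, y')) \<in> points"
        unfolding f[OF y] f[OF y'] using cubes by (auto simp: points_def)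
      ultimately show "length_dist (f a) (f (p (l, y'))) \<le> length_dist (f a) (f (p (l, y))) + cube_dist (cdim l) y y'"
        using triangle[OF fa, of "f (p (l, y))" "f (p (l, y'))"] by linarith
    qed
    then show ?thesis using fa by simp
  qed
  show "\<exists>\<eta>>0. geodesically_convex points length_dist (W \<inter> mball x \<eta>)"
  proof (intro exI conjI)
    \<comment> \<open>With radius \<open>\<epsilon>/8\<close>, geodesics between points of the ball and all paths of nearly minimal
      length considered stay within \<open>\<epsilon>/2\<close> of \<open>x\<close>, where the retraction is defined.\<close>
    show "0 < \<epsilon>/8" using eps by simp
    show "geodesically_convex points length_dist (W \<inter> mball x (\<epsilon>/8))"
      unfolding geodesically_convex_def
    proof (intro conjI ballI impI allI subsetI)
      fix z assume "z \<in> W \<inter> mball x (\<epsilon>/8)"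
      then show "z \<in> points" using sub by blast
    next
      fix a b S q
      assume a: "a \<in> W \<inter> mball x (\<epsilon>/8)" and b: "b \<in> W \<inter> mball x (\<epsilon>/8)"
        and S: "geodesic_segment points length_dist a b S" and q: "q \<in> S"
      have ab: "a \<in> points" "b \<in> points" "a \<in> W" "b \<in> W" "length_dist x a < \<epsilon>/8" "length_dist x b < \<epsilon>/8"
        using a b by (auto simp: mball_def)
      have qp: "q \<in> points" "length_dist a q + length_dist q b = length_dist a b"
        using geodesic_segment_between[OF S q] by auto
      have xq: "length_dist x q < \<epsilon>/8" by (rule CAT0_ball_convex[OF CAT0_points xp ab(1,2) S q ab(5,6)])
      have "length_dist a b < \<epsilon>/4"
        using triangle[OF ab(1) xp ab(2)] commute[of a x] ab by linarith
      then have dq: "length_dist x a + length_dist a q < \<epsilon>/2" "length_dist x q + length_dist q b < \<epsilon>/2"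
        using qp(2) ab xq nonneg[of a q] nonneg[of q b] by linarith+
      have xlt: "length_dist x a < \<epsilon>/2" "length_dist x b < \<epsilon>/2" "length_dist x q < \<epsilon>/2"
        using ab xq eps by auto
      have le: "length_dist a (f q) \<le> length_dist a q" "length_dist (f q) b \<le> length_dist q b"
        using f_short[OF ab(1) qp(1) dq(1)] f_short[OF qp(1) ab(2) dq(2)] f_id[OF ab(3) xlt(1)] f_id[OF ab(4) xlt(2)]
        by simp_all
      have fq: "f q \<in> W" by (rule f_W[OF qp(1) xlt(3)])
      then have fqp: "f q \<in> points" using sub by blast
      have "length_dist a b \<le> length_dist a (f q) + length_dist (f q) b"
        by (rule triangle[OF ab(1) fqp ab(2)])
      then have "length_dist a (f q) = length_dist a q" "length_dist (f q) b = length_dist q b"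
        using le qp(2) by linarith+
      then have "f q = q" by (rule CAT0_unique_between[OF CAT0_points ab(1,2) S q fqp])
      then show "q \<in> W \<inter> mball x (\<epsilon>/8)" using fq xq xp qp(1) by (simp add: mball_def)
    qed
  qed
qed

end

section \<open>Full links in coordinates\<close>

definition edge_direction :: "nat \<Rightarrow> (nat \<Rightarrow> real) \<Rightarrow> nat \<Rightarrow> nat \<Rightarrow> real" where
  "edge_direction n w a = (\<lambda>k\<in>{..<n}. if k = a then 1 - 2 * w k else 0)"

lemma move_coord: "k < n \<Longrightarrow> move n w u t k = w k + t * u k"
  by (simp add: move_def)

lemma L2_set_single:
  fixes n :: nat
  assumes "a < n" "\<And>k. \<lbrakk>k < n; k \<noteq> a\<rbrakk> \<Longrightarrow> u k = 0"
  shows "L2_set u {..<n} = \<bar>u a\<bar>"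
proof -
  have "(\<Sum>k<n. (u k)\<^sup>2) = (\<Sum>k<n. if k = a then (u a)\<^sup>2 else 0)"
    by (rule sum.cong) (use assms in auto)
  also have "\<dots> = (u a)\<^sup>2" by (subst sum.delta) (use assms(1) in auto)
  finally show ?thesis by (simp add: L2_set_def)
qed

lemma edge_direction_in:
  assumes w: "w \<in> cube_vertices n" and a: "a \<in> A" "a < n"
  shows "edge_direction n w a \<in> directions n (subcube n w A) w"
proof -
  have wa: "w a = 0 \<or> w a = 1" using w a by (simp add: cube_vertices_iff)
  have "L2_set (edge_direction n w a) {..<n} = \<bar>edge_direction n w a a\<bar>"
    by (rule L2_set_single[OF a(2)]) (simp add: edge_direction_def)
  then have "L2_set (edge_direction n w a) {..<n} = 1" using wa a(2) by (auto simp: edge_direction_def)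
  moreover have "move n w (edge_direction n w a) t \<in> subcube n w A" if "t \<in> {0..1}" for t
  proof -
    have "0 \<le> w k + t * edge_direction n w a k \<and> w k + t * edge_direction n w a k \<le> 1" if "k < n" for k
      using w wa \<open>t \<in> {0..1}\<close> that by (force simp: cube_vertices_iff edge_direction_def)
    then show ?thesis using a by (auto simp: subcube_def unit_cube_iff move_def edge_direction_def)
  qed
  ultimately show ?thesis by (auto simp: directions_def edge_direction_def intro!: exI[of _ 1])
qed

lemma unique_edge_direction:
  assumes w: "w \<in> cube_vertices n" and u: "u \<in> directions n (subcube n w A) w"
    and a: "a < n" "\<And>k. \<lbrakk>k < n; k \<noteq> a\<rbrakk> \<Longrightarrow> u k = 0"
  shows "u = edge_direction n w a" "a \<in> A"
proof -
  have wa: "w a = 0 \<or> w a = 1" using w a by (simp add: cube_vertices_iff)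
  have ua: "\<bar>u a\<bar> = 1" using u L2_set_single[OF a] by (simp add: directions_def)
  obtain t where t: "0 < t" "move n w u t \<in> subcube n w A"
    using u by (force simp: directions_def)
  have "0 \<le> w a + t * u a" "w a + t * u a \<le> 1" "a \<in> A \<or> w a + t * u a = w a"
    using t(2) a(1) by (auto simp: subcube_def unit_cube_iff move_coord)
  moreover have "u a = 1 \<or> u a = -1" using ua by linarith
  ultimately have "u a = 1 - 2 * w a" and "a \<in> A" using wa t(1) by auto
  then show "u = edge_direction n w a" "a \<in> A"
    using u a by (auto simp: directions_def edge_direction_def extensional_def fun_eq_iff)
qed

lemma directions_edge:
  assumes "w \<in> cube_vertices n" "a < n"
  shows "directions n (subcube n w {a}) w = {edge_direction n w a}"
proof
  show "directions n (subcube n w {a}) w \<subseteq> {edge_direction n w a}"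
  proof
    fix u assume u: "u \<in> directions n (subcube n w {a}) w"
    then obtain t where t: "0 < t" "move n w u t \<in> subcube n w {a}" by (force simp: directions_def)
    have "u k = 0" if "k < n" "k \<noteq> a" for k
      using t that by (auto simp: subcube_def move_coord)
    then show "u \<in> {edge_direction n w a}" using unique_edge_direction(1)[OF assms(1) u assms(2)] by simp
  qed
  show "{edge_direction n w a} \<subseteq> directions n (subcube n w {a}) w"
    using edge_direction_in[OF assms(1), of a "{a}"] assms(2) by simp
qed

text \<open>The diagonal direction, normalised; the segment in this direction runs through the interior
  of the face.\<close>

lemma ex_interior_direction:
  assumes w: "w \<in> cube_vertices n" and A: "A \<subseteq> {..<n}" "A \<noteq> {}"
  obtains u where "u \<in> directions n (subcube n w A) w" "\<forall>t. 0 < t \<and> t < 1 \<longrightarrow> free n (move n w u t) = A"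
proof -
  have fin: "finite A" by (rule finite_subset[OF A(1)]) simp
  define s where "s = sqrt (card A)"
  have s: "1 \<le> s" using A(2) fin by (simp add: s_def card_gt_0_iff Suc_leI)
  define u where "u = (\<lambda>k\<in>{..<n}. if k \<in> A then (1 - 2 * w k) / s else 0)"
  have wk: "w k = 0 \<or> w k = 1" if "k < n" for k using w that by (simp add: cube_vertices_iff)
  have "(\<Sum>k<n. (u k)\<^sup>2) = (\<Sum>k\<in>A. (u k)\<^sup>2)"
    by (rule sum.mono_neutral_right) (use A in \<open>auto simp: u_def\<close>)
  also have "\<dots> = (\<Sum>k\<in>A. 1 / s\<^sup>2)"
  proof (rule sum.cong[OF refl])
    fix k assume "k \<in> A"
    then show "(u k)\<^sup>2 = 1 / s\<^sup>2" using wk[of k] A by (auto simp: u_def power_divide)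
  qed
  also have "\<dots> = 1" using fin A(2) by (simp add: s_def)
  finally have norm: "L2_set u {..<n} = 1" by (simp add: L2_set_def)
  have ts: "0 \<le> t / s" "t / s \<le> 1" if "t \<in> {0..1}" for t using that s by (auto simp: divide_le_eq)
  have coord: "move n w u t k = (if k \<in> A then (if w k = 0 then t / s else 1 - t / s) else w k)" if "k < n" for t k
    using wk[OF that] that by (auto simp: move_coord u_def)
  have "move n w u t \<in> subcube n w A" if "t \<in> {0..1}" for t
  proof -
    have "0 \<le> move n w u t k \<and> move n w u t k \<le> 1" if "k < n" for k
      using ts[OF \<open>t \<in> {0..1}\<close>] wk[OF that] unfolding coord[OF that] by auto
    then show ?thesis using coord by (auto simp: subcube_def unit_cube_iff) (simp add: move_def)
  qed
  then have "u \<in> directions n (subcube n w A) w"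
    using norm by (auto simp: directions_def u_def intro!: exI[of _ 1])
  moreover have "free n (move n w u t) = A" if t: "0 < t" "t < 1" for t
  proof -
    have "0 < t / s" "t / s < 1" using t s by (auto simp: divide_less_eq)
    then have "k \<in> free n (move n w u t) \<longleftrightarrow> k \<in> A" if "k < n" for k
      using wk[OF that] that unfolding free_def mem_Collect_eq coord[OF that] by auto
    then show ?thesis using A(1) free_subset by blast
  qed
  ultimately show thesis using that by blast
qed

context cubed_complex
begin

definition link_simplex :: "'x \<Rightarrow> 'i \<Rightarrow> (nat \<Rightarrow> real) \<Rightarrow> nat set \<Rightarrow> ('i \<times> (nat \<Rightarrow> real) \<times> (nat \<Rightarrow> real)) set set" where
  "link_simplex v l w A = (\<lambda>u. link_point v (l, w, u)) ` directions (cdim l) (subcube (cdim l) w A) w"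

lemma image_subcube_in_points: "\<lbrakk>l \<in> \<Lambda>; y \<in> subcube (cdim l) w A\<rbrakk> \<Longrightarrow> p (l, y) \<in> points"
  by (auto simp: points_def subcube_def)

lemma link_iff:
  "\<sigma> \<in> link v W \<longleftrightarrow> (\<exists>l w A. (l, w) \<in> lifts v \<and> w \<in> cube_vertices (cdim l) \<and> A \<subseteq> {..<cdim l} \<and> A \<noteq> {} \<and>
      (\<forall>y\<in>subcube (cdim l) w A. p (l, y) \<in> W) \<and> \<sigma> = link_simplex v l w A)" (is "_ \<longleftrightarrow> ?R")
proof
  assume "\<sigma> \<in> link v W"
  then obtain l w F where F: "l \<in> \<Lambda>" "w \<in> cube_vertices (cdim l)" "p (l, w) = v" "F \<in> cube_faces (cdim l)"
      "w \<in> F" "F \<noteq> {w}" "p ` ({l} \<times> F) \<subseteq> W"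
      "\<sigma> = (\<lambda>u. link_point v (l, w, u)) ` directions (cdim l) F w"
    unfolding link_def by blast
  obtain A where A: "A \<subseteq> {..<cdim l}" "F = subcube (cdim l) w A"
    using cube_face_as_subcube[OF F(4,5)] by blast
  have "A \<noteq> {}"
  proof
    assume "A = {}"
    then have "F \<subseteq> {w}" using A vertex_in_cube[OF F(2)] by (auto simp: subcube_def intro: unit_cube_eqI)
    then show False using F(5,6) by blast
  qed
  moreover have "(l, w) \<in> lifts v" using F vertex_in_cube by (simp add: lifts_def)
  moreover have "\<forall>y\<in>subcube (cdim l) w A. p (l, y) \<in> W" using F(7) A(2) by blast
  ultimately show ?R using F A unfolding link_simplex_def by blast
next
  assume ?R
  then obtain l w A where A: "(l, w) \<in> lifts v" "w \<in> cube_vertices (cdim l)" "A \<subseteq> {..<cdim l}" "A \<noteq> {}"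
      "\<forall>y\<in>subcube (cdim l) w A. p (l, y) \<in> W" "\<sigma> = link_simplex v l w A" by blast
  let ?F = "subcube (cdim l) w A"
  have w: "w k = 0 \<or> w k = 1" if "k < cdim l" for k using A(2) that by (simp add: cube_vertices_iff)
  have "?F \<in> cube_faces (cdim l)" by (rule subcube_in_cube_faces(2)[OF A(3) w])
  moreover have "w \<in> ?F" by (rule self_in_subcube[OF vertex_in_cube[OF A(2)]])
  moreover have "?F \<noteq> {w}"
  proof -
    obtain a where a: "a \<in> A" "a < cdim l" using A(3,4) by auto
    then have "nudge w a \<in> ?F" using nudge_in_subcube[OF \<open>w \<in> ?F\<close>] by blast
    moreover have "nudge w a a \<noteq> w a" using w[OF a(2)] by (auto simp: nudge_def)
    ultimately show ?thesis by fastforce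
  qed
  moreover have "p ` ({l} \<times> ?F) \<subseteq> W" using A(5) by blast
  moreover have "l \<in> \<Lambda>" "p (l, w) = v" using A(1) by (auto simp: lifts_def)
  ultimately show "\<sigma> \<in> link v W" using A(2,6) unfolding link_def link_simplex_def by blast
qed

lemma link_simplex_edge:
  assumes "w \<in> cube_vertices (cdim l)" "a < cdim l"
  shows "link_simplex v l w {a} = {link_point v (l, w, edge_direction (cdim l) w a)}"
  unfolding link_simplex_def directions_edge[OF assms] by simp

text \<open>Equality of points of the glued link is translated into equality of points of \<open>X\<close> close to
  \<open>v\<close>.\<close>

lemma glued_directions:
  assumes w: "(l, w) \<in> lifts v" "w \<in> cube_vertices (cdim l)"
    and w': "(l', w') \<in> lifts v" "w' \<in> cube_vertices (cdim l')"
    and u: "u \<in> directions (cdim l) (subcube (cdim l) w A) w"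
    and u': "u' \<in> directions (cdim l') (subcube (cdim l') w' B) w'"
    and eq: "link_point v (l, w, u) = link_point v (l', w', u')"
  obtains t where "0 < t" "t \<le> 1/2" "p (l, move (cdim l) w u t) = p (l', move (cdim l') w' u' t)"
    "move (cdim l) w u t \<in> subcube (cdim l) w A" "move (cdim l') w' u' t \<in> subcube (cdim l') w' B"
proof -
  have "u' \<in> directions (cdim l') (unit_cube (cdim l')) w'"
    using u' subcube_subset[of "cdim l'" w' B] unfolding directions_def by blast
  then have "(l', w', u') \<in> link_directions v"
    using w' by (auto simp: link_directions_def lifts_def)
  then have "((l, w, u), (l', w', u')) \<in> link_gluing v"
    using eq_equiv_class[OF _ equiv_link_gluing] eq unfolding link_point_def by blast
  then obtain e where e: "0 < e" "\<forall>t\<in>{0..e}. p (l, move (cdim l) w u t) = p (l', move (cdim l') w' u' t)"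
    unfolding link_gluing_def by blast
  obtain f g where fg: "0 < f" "0 < g" "\<forall>t\<in>{0..f}. move (cdim l) w u t \<in> subcube (cdim l) w A"
      "\<forall>t\<in>{0..g}. move (cdim l') w' u' t \<in> subcube (cdim l') w' B"
    using u u' unfolding directions_def by blast
  define t where "t = min (1/2) (min e (min f g))"
  have t: "0 < t" "t \<le> 1/2" "t \<le> e" "t \<le> f" "t \<le> g" using e(1) fg(1,2) by (auto simp: t_def)
  show thesis by (rule that[of t]) (use t e(2) fg(3,4) in auto)
qed

text \<open>A simplex of \<open>Lk(v, W)\<close> may come from another cube than \<open>l\<close>. A point on a diagonal direction
  of the face in \<open>l\<close> is glued to a point of a cell of \<open>W\<close>, and its smallest face is the whole
  face.\<close>

lemma face_in_subcomplex_if_link_simplex: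
  assumes W: "subcomplex W" and w: "(l, w) \<in> lifts v" "w \<in> cube_vertices (cdim l)"
    and A: "A \<subseteq> {..<cdim l}" "A \<noteq> {}" and link: "link_simplex v l w A \<in> link v W"
    and y: "y \<in> subcube (cdim l) w A"
  shows "p (l, y) \<in> W"
proof -
  obtain u where u: "u \<in> directions (cdim l) (subcube (cdim l) w A) w"
      "\<forall>t. 0 < t \<and> t < 1 \<longrightarrow> free (cdim l) (move (cdim l) w u t) = A"
    using ex_interior_direction[OF w(2) A] .
  obtain l' w' B where B: "(l', w') \<in> lifts v" "w' \<in> cube_vertices (cdim l')"
      "\<forall>y\<in>subcube (cdim l') w' B. p (l', y) \<in> W" "link_simplex v l w A = link_simplex v l' w' B"
    using link unfolding link_iff by blast
  have "link_point v (l, w, u) \<in> link_simplex v l' w' B" using u(1) B(4) unfolding link_simplex_def by blast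
  then obtain u' where u': "u' \<in> directions (cdim l') (subcube (cdim l') w' B) w'"
      "link_point v (l, w, u) = link_point v (l', w', u')"
    unfolding link_simplex_def by blast
  obtain t where t: "0 < t" "t \<le> 1/2" "p (l, move (cdim l) w u t) = p (l', move (cdim l') w' u' t)"
    "move (cdim l) w u t \<in> subcube (cdim l) w A" "move (cdim l') w' u' t \<in> subcube (cdim l') w' B"
    using glued_directions[OF w B(1,2) u(1) u'] .
  let ?m = "move (cdim l) w u t"
  have free: "free (cdim l) ?m = A" using u(2) t(1,2) by simp
  have "?m \<in> unit_cube (cdim l)" using t(4) subcube_subset by blast
  then have "(l, ?m) \<in> lifts (p (l, ?m))" using w(1) by (auto simp: lifts_def)
  moreover have "p (l, ?m) \<in> W" using t(3,5) B(3) by simp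
  moreover have "y \<in> subcube (cdim l) ?m A" using y t(4) by (auto simp: subcube_def)
  ultimately show ?thesis using subcomplex_contains_face[OF W] free by blast
qed

text \<open>The smallest face of a point close to \<open>v\<close> has the same dimension in all cubes that contain
  this point. A singleton simplex contains the direction of an edge, and therefore \<open>u\<close> moves only
  one coordinate.\<close>

lemma link_vertex_is_edge:
  assumes w: "(l, w) \<in> lifts v" "w \<in> cube_vertices (cdim l)"
    and u: "u \<in> directions (cdim l) (subcube (cdim l) w A) w"
    and link: "{link_point v (l, w, u)} \<in> link v points"
  obtains a where "a \<in> A" "u = edge_direction (cdim l) w a"
proof -
  obtain l' w' B where B: "(l', w') \<in> lifts v" "w' \<in> cube_vertices (cdim l')" "B \<subseteq> {..<cdim l'}" "B \<noteq> {}"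
      "{link_point v (l, w, u)} = link_simplex v l' w' B"
    using link unfolding link_iff by blast
  then obtain b where b: "b \<in> B" "b < cdim l'" by blast
  let ?e = "edge_direction (cdim l') w' b"
  have "link_point v (l', w', ?e) \<in> link_simplex v l' w' B"
    using edge_direction_in[OF B(2) b] unfolding link_simplex_def by blast
  then have eq: "link_point v (l, w, u) = link_point v (l', w', ?e)" using B(5) by (metis singletonD)
  have e: "?e \<in> directions (cdim l') (subcube (cdim l') w' {b}) w'"
    using edge_direction_in[OF B(2) _ b(2), of "{b}"] by simp
  obtain t where t: "0 < t" "t \<le> 1/2" "p (l, move (cdim l) w u t) = p (l', move (cdim l') w' ?e t)"
    "move (cdim l) w u t \<in> subcube (cdim l) w A" "move (cdim l') w' ?e t \<in> subcube (cdim l') w' {b}"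
    using glued_directions[OF w B(1,2) u e eq] .
  let ?m = "move (cdim l) w u t" and ?m' = "move (cdim l') w' ?e t"
  have cubes: "?m \<in> unit_cube (cdim l)" "?m' \<in> unit_cube (cdim l')" using t(4,5) subcube_subset by blast+
  have "(l, ?m) \<in> lifts (p (l, ?m))" "(l', ?m') \<in> lifts (p (l, ?m))"
    using w(1) B(1) cubes t(3) by (auto simp: lifts_def)
  then obtain h \<pi> s where "transports l ?m l' ?m' h \<pi> s" by (rule ex_transport)
  then have "card (free (cdim l) ?m) = card (free (cdim l') ?m')"
    unfolding transports_def by (metis bij_betw_same_card)
  moreover have "free (cdim l') ?m' = {b}"
  proof -
    have "k \<in> free (cdim l') ?m' \<longleftrightarrow> k = b" if "k < cdim l'" for k
      using cube_vertices_iff[THEN iffD1, OF B(2)] that t(1,2)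
      unfolding free_def mem_Collect_eq move_coord[OF that] by (auto simp: edge_direction_def)
    then show ?thesis using b(2) free_subset by blast
  qed
  ultimately have "card (free (cdim l) ?m) = 1" by simp
  then obtain a where a: "free (cdim l) ?m = {a}" by (auto simp: card_1_singleton_iff)
  then have an: "a < cdim l" by (auto simp: free_def)
  have "u k = 0" if k: "k < cdim l" "k \<noteq> a" for k
  proof -
    have "?m k = 0 \<or> ?m k = 1" by (rule not_free[OF cubes(1) k(1)]) (use a k in auto)
    moreover have "w k = 0 \<or> w k = 1" using w(2) k(1) by (simp add: cube_vertices_iff)
    moreover have "\<bar>u k\<bar> \<le> 1"
    proof -
      have "\<bar>u k\<bar> \<le> L2_set (\<lambda>k. \<bar>u k\<bar>) {..<cdim l}" by (rule member_le_L2_set) (use k in auto)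
      then show ?thesis using u by (simp add: directions_def L2_set_def)
    qed
    then have "\<bar>t * u k\<bar> \<le> 1/2 * 1"
      unfolding abs_mult by (intro mult_mono) (use t in auto)
    ultimately have "t * u k = 0" using move_coord[OF k(1), of w u t] by auto
    then show ?thesis using t(1) by simp
  qed
  then show thesis using that unique_edge_direction[OF w(2) u an] by blast
qed

lemma full_link_iff_spans_faces:
  assumes W: "subcomplex W" and v: "v \<in> W"
  shows "full_subcomplex (link v W) (link v points) \<longleftrightarrow> spans_faces W v"
proof
  assume full: "full_subcomplex (link v W) (link v points)"
  have "p (l, y) \<in> W"
    if w: "(l, w) \<in> lifts v" "w \<in> cube_vertices (cdim l)" and A: "A \<subseteq> {..<cdim l}"
      and edges: "\<forall>a\<in>A. p (l, nudge w a) \<in> W" and y: "y \<in> subcube (cdim l) w A" for l w A y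
  proof (cases "A = {}")
    case True
    then have "y = w" using y vertex_in_cube[OF w(2)] by (auto simp: subcube_def intro: unit_cube_eqI)
    then show ?thesis using v w(1) by (simp add: lifts_def)
  next
    case False
    have l: "l \<in> \<Lambda>" using w(1) by (simp add: lifts_def)
    have "link_simplex v l w A \<in> link v points"
      unfolding link_iff
      by (intro exI[of _ l] exI[of _ w] exI[of _ A] conjI ballI w A False refl image_subcube_in_points[OF l])
    moreover have "{\<xi>} \<in> link v W" if \<xi>: "\<xi> \<in> link_simplex v l w A" "{\<xi>} \<in> link v points" for \<xi>
    proof -
      obtain u where u: "u \<in> directions (cdim l) (subcube (cdim l) w A) w" "\<xi> = link_point v (l, w, u)"
        using \<xi>(1) unfolding link_simplex_def by blast
      obtain a where a: "a \<in> A" "u = edge_direction (cdim l) w a"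
        using link_vertex_is_edge[OF w u(1)] \<xi>(2) u(2) by blast
      have an: "a < cdim l" using a A by blast
      have wc: "w \<in> unit_cube (cdim l)" by (rule vertex_in_cube[OF w(2)])
      have "p (l, z) \<in> W" if z: "z \<in> subcube (cdim l) w {a}" for z
      proof -
        have "z \<in> subcube (cdim l) (nudge w a) {a}" using z by (auto simp: subcube_def nudge_def)
        then show ?thesis
          using subcomplex_contains_face[OF W lift_self[OF l nudge_cube[OF wc an]]] edges a(1)
            free_nudge[OF wc an] by blast
      qed
      then show ?thesis
        unfolding link_iff u(2) a(2) link_simplex_edge[OF w(2) an, symmetric] using w an by blast
    qed
    ultimately have "link_simplex v l w A \<in> link v W" using full unfolding full_subcomplex_def by blast
    then show ?thesis using face_in_subcomplex_if_link_simplex[OF W w A False] y by blast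
  qed
  then show "spans_faces W v" unfolding spans_faces_def by blast
next
  assume span: "spans_faces W v"
  have "link v W \<subseteq> link v points"
    using subcomplex_subset_points[OF W] unfolding subset_iff link_iff by blast
  moreover have "\<sigma> \<in> link v W"
    if \<sigma>: "\<sigma> \<in> link v points" "\<forall>\<xi>\<in>\<sigma>. {\<xi>} \<in> link v points \<longrightarrow> {\<xi>} \<in> link v W" for \<sigma>
  proof -
    obtain l w A where A: "(l, w) \<in> lifts v" "w \<in> cube_vertices (cdim l)" "A \<subseteq> {..<cdim l}" "A \<noteq> {}"
        "\<sigma> = link_simplex v l w A"
      using \<sigma>(1) unfolding link_iff by blast
    have l: "l \<in> \<Lambda>" and wc: "w \<in> unit_cube (cdim l)" using A(1) by (auto simp: lifts_def)
    have "p (l, nudge w a) \<in> W" if a: "a \<in> A" for a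
    proof -
      have an: "a < cdim l" using a A(3) by blast
      let ?\<xi> = "link_point v (l, w, edge_direction (cdim l) w a)"
      have "?\<xi> \<in> \<sigma>" unfolding A(5) link_simplex_def using edge_direction_in[OF A(2) a an] by blast
      moreover have "\<forall>y\<in>subcube (cdim l) w {a}. p (l, y) \<in> points"
        using image_subcube_in_points[OF l] by blast
      then have "{?\<xi>} \<in> link v points"
        unfolding link_iff link_simplex_edge[OF A(2) an, symmetric] using A(1,2) an by blast
      ultimately have "link_simplex v l w {a} \<in> link v W"
        using \<sigma>(2) unfolding link_simplex_edge[OF A(2) an] by blast
      moreover have "nudge w a \<in> subcube (cdim l) w {a}"
        using nudge_in_subcube[OF self_in_subcube[OF wc] _ an] by blast
      ultimately show ?thesis
        using face_in_subcomplex_if_link_simplex[OF W A(1,2), of "{a}"] an by blast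
    qed
    then have "\<forall>y\<in>subcube (cdim l) w A. p (l, y) \<in> W"
      using span A(1-3) unfolding spans_faces_def by blast
    then show ?thesis unfolding link_iff using A by blast
  qed
  ultimately show "full_subcomplex (link v W) (link v points)" unfolding full_subcomplex_def by blast
qed

end

section \<open>Distances near a vertex\<close>

text \<open>The point whose displacement from the vertex \<open>w\<close> in the coordinate \<open>k\<close> is \<open>e k\<close>, whichever
  of 0 and 1 the coordinate \<open>w k\<close> is.\<close>

definition corner :: "nat \<Rightarrow> (nat \<Rightarrow> real) \<Rightarrow> (nat \<Rightarrow> real) \<Rightarrow> nat \<Rightarrow> real" where
  "corner n w e = (\<lambda>k\<in>{..<n}. \<bar>w k - e k\<bar>)"

lemma corner_props:
  assumes w: "w \<in> cube_vertices n" and e: "\<And>k. k < n \<Longrightarrow> 0 \<le> e k \<and> e k \<le> 1"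
  shows "corner n w e \<in> unit_cube n"
    and "k < n \<Longrightarrow> \<bar>corner n w e k - w k\<bar> = e k"
    and "free n (corner n w e) = {k. k < n \<and> 0 < e k \<and> e k < 1}"
proof -
  have *: "corner n w e k = (if w k = 0 then e k else 1 - e k)" "w k = 0 \<or> w k = 1" if "k < n" for k
    using w e[OF that] that by (auto simp: corner_def cube_vertices_iff)
  show "corner n w e \<in> unit_cube n"
    unfolding unit_cube_iff
  proof (intro conjI allI impI)
    show "corner n w e \<in> extensional {..<n}" by (simp add: corner_def)
    fix k assume "k < n"
    then show "0 \<le> corner n w e k" "corner n w e k \<le> 1" using *[of k] e[of k] by auto
  qed
  show "k < n \<Longrightarrow> \<bar>corner n w e k - w k\<bar> = e k" using *[of k] e[of k] by auto
  show "free n (corner n w e) = {k. k < n \<and> 0 < e k \<and> e k < 1}"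
    using *(1) by (auto simp: free_def split: if_splits)
qed

lemma cube_dist_corner:
  assumes w: "w \<in> cube_vertices n" and e: "\<And>k. k < n \<Longrightarrow> 0 \<le> e k \<and> e k \<le> 1"
    and e': "\<And>k. k < n \<Longrightarrow> 0 \<le> e' k \<and> e' k \<le> 1"
  shows "(cube_dist n (corner n w e) (corner n w e'))\<^sup>2 = (\<Sum>k<n. (e k - e' k)\<^sup>2)"
  unfolding cube_dist_sq
proof (rule sum.cong[OF refl])
  fix k assume "k \<in> {..<n}"
  then have k: "k < n" "w k = 0 \<or> w k = 1" using w by (auto simp: cube_vertices_iff)
  then show "(corner n w e k - corner n w e' k)\<^sup>2 = (e k - e' k)\<^sup>2"
    using e[of k] e'[of k] by (auto simp: corner_def power2_commute)
qed

lemma corner_zero: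
  assumes "w \<in> cube_vertices n"
  shows "corner n w (\<lambda>_. 0) = w"
proof (rule unit_cube_eqI)
  show "corner n w (\<lambda>_. 0) \<in> unit_cube n" by (rule corner_props[OF assms]) simp
  show "w \<in> unit_cube n" by (rule vertex_in_cube[OF assms])
  fix k assume "k < n"
  then show "corner n w (\<lambda>_. 0) k = w k" using assms by (auto simp: corner_def cube_vertices_iff)
qed

text \<open>The largest displacement exceeds all others, and also 0, by at least \<open>\<kappa>\<close>. The value 0 stands
  for the coordinates in which the point agrees with the centre, which include all directions
  missing from the cube; it makes the condition independent of the cube. Being symmetric in the
  coordinates, the condition is preserved by gluings even if these identify several edges at a
  vertex.\<close>

definition dominant :: "nat \<Rightarrow> (nat \<Rightarrow> real) \<Rightarrow> (nat \<Rightarrow> real) \<Rightarrow> real \<Rightarrow> bool" where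
  "dominant n c y \<kappa> \<longleftrightarrow> (\<exists>i<n. \<kappa> \<le> \<bar>y i - c i\<bar> \<and> (\<forall>j<n. j \<noteq> i \<longrightarrow> \<bar>y j - c j\<bar> + \<kappa> \<le> \<bar>y i - c i\<bar>))"

lemma dominant_perturb:
  assumes "dominant n c y \<kappa>"
  shows "dominant n c y' (\<kappa> - sqrt 2 * cube_dist n y y')"
proof -
  obtain i where i: "i < n" "\<kappa> \<le> \<bar>y i - c i\<bar>" "\<And>j. j < n \<Longrightarrow> j \<noteq> i \<Longrightarrow> \<bar>y j - c j\<bar> + \<kappa> \<le> \<bar>y i - c i\<bar>"
    using assms unfolding dominant_def by blast
  let ?D = "cube_dist n y y'"
  have "?D * 1 \<le> ?D * sqrt 2" by (rule mult_left_mono) auto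
  then have "\<kappa> - sqrt 2 * ?D \<le> \<bar>y' i - c i\<bar>"
    using i(2) coord_le_cube_dist[OF i(1), of y y'] by (simp add: mult.commute)
  moreover have "\<bar>y' j - c j\<bar> + (\<kappa> - sqrt 2 * ?D) \<le> \<bar>y' i - c i\<bar>" if "j < n" "j \<noteq> i" for j
    using i(3)[OF that] two_coords_le_cube_dist[OF that(1) i(1) that(2), of y y'] by linarith
  ultimately show ?thesis using i(1) unfolding dominant_def by blast
qed

lemma abs_flip_diff: "\<bar>flip s a - flip s b\<bar> = \<bar>a - b\<bar>"
  by (simp add: flip_def abs_minus_commute)

context cubed_complex
begin

lemma chart_change_coords:
  assumes sep: "separated x \<epsilon>" and y: "near x (\<epsilon>/2) l c y" and y': "near x (\<epsilon>/2) l' c' y'"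
    and eq: "p (l, y) = p (l', y')"
  obtains \<pi> where "bij_betw \<pi> (free (cdim l') y') (free (cdim l) y)"
    "\<forall>k\<in>free (cdim l') y'. \<bar>y' k - c' k\<bar> = \<bar>y (\<pi> k) - c (\<pi> k)\<bar>"
    "\<forall>k\<in>free (cdim l') y'. p (l, nudge c (\<pi> k)) = p (l', nudge c' k)"
proof -
  obtain h \<pi> s where h: "transports l y l' y' h \<pi> s" "h c = c'" using chart_change[OF sep y y' eq] .
  have cF: "c \<in> subcube (cdim l) y (free (cdim l) y)" by (rule near_center_in_face[OF sep y])
  have yF: "y \<in> subcube (cdim l) y (free (cdim l) y)"
    using y by (intro self_in_subcube) (simp add: near_def)
  have hy: "h y = y'" using h unfolding transports_def by blast
  show thesis
  proof (rule that)
    show "bij_betw \<pi> (free (cdim l') y') (free (cdim l) y)" using h(1) unfolding transports_def by blast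
    show "\<forall>k\<in>free (cdim l') y'. \<bar>y' k - c' k\<bar> = \<bar>y (\<pi> k) - c (\<pi> k)\<bar>"
    proof
      fix k assume k: "k \<in> free (cdim l') y'"
      show "\<bar>y' k - c' k\<bar> = \<bar>y (\<pi> k) - c (\<pi> k)\<bar>"
        using transports_coord[OF h(1) yF k] transports_coord[OF h(1) cF k] hy h(2) by (simp add: abs_flip_diff)
    qed
    show "\<forall>k\<in>free (cdim l') y'. p (l, nudge c (\<pi> k)) = p (l', nudge c' k)"
      using transports_nudge(2)[OF h(1) near_lift[OF y'] cF] h(2) by simp
  qed
qed

lemma near_not_free:
  assumes "separated x \<epsilon>" "near x (\<epsilon>/2) l c y" "k < cdim l" "k \<notin> free (cdim l) y"
  shows "c k = y k"
  using near_center_in_face(1)[OF assms(1,2)] assms(3,4) by (simp add: subcube_def)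

lemma dominant_chart_change:
  assumes sep: "separated x \<epsilon>" and y: "near x (\<epsilon>/2) l c y" and y': "near x (\<epsilon>/2) l' c' y'"
    and eq: "p (l, y) = p (l', y')" and dom: "dominant (cdim l) c y \<kappa>" and \<kappa>: "0 < \<kappa>"
  shows "dominant (cdim l') c' y' \<kappa>"
proof -
  obtain \<pi> where \<pi>: "bij_betw \<pi> (free (cdim l') y') (free (cdim l) y)"
    "\<forall>k\<in>free (cdim l') y'. \<bar>y' k - c' k\<bar> = \<bar>y (\<pi> k) - c (\<pi> k)\<bar>"
    "\<forall>k\<in>free (cdim l') y'. p (l, nudge c (\<pi> k)) = p (l', nudge c' k)"
    using chart_change_coords[OF sep y y' eq] by blast
  obtain i where i: "i < cdim l" "\<kappa> \<le> \<bar>y i - c i\<bar>"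
      "\<And>j. j < cdim l \<Longrightarrow> j \<noteq> i \<Longrightarrow> \<bar>y j - c j\<bar> + \<kappa> \<le> \<bar>y i - c i\<bar>"
    using dom unfolding dominant_def by blast
  have "i \<in> free (cdim l) y" using near_not_free[OF sep y i(1)] i(2) \<kappa> by force
  then have "i \<in> \<pi> ` free (cdim l') y'" using bij_betw_imp_surj_on[OF \<pi>(1)] by simp
  then obtain i' where i': "i' \<in> free (cdim l') y'" "\<pi> i' = i" by blast
  have "\<bar>y' j - c' j\<bar> + \<kappa> \<le> \<bar>y' i' - c' i'\<bar>" if j: "j < cdim l'" "j \<noteq> i'" for j
  proof (cases "j \<in> free (cdim l') y'")
    case True
    then have "\<pi> j \<in> free (cdim l) y" using \<pi>(1) bij_betwE by blast
    then have "\<pi> j < cdim l" using free_subset by blast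
    moreover have "\<pi> j \<noteq> i" using \<pi>(1) True i' j(2) unfolding bij_betw_def inj_on_def by blast
    ultimately show ?thesis using i(3) bspec[OF \<pi>(2) True] bspec[OF \<pi>(2) i'(1)] i'(2) by simp
  next
    case False
    then show ?thesis using near_not_free[OF sep y' j(1)] bspec[OF \<pi>(2) i'(1)] i'(2) i(2) by simp
  qed
  moreover have "i' < cdim l'" using i'(1) free_subset by blast
  ultimately show ?thesis using bspec[OF \<pi>(2) i'(1)] i'(2) i(2) unfolding dominant_def by auto
qed

lemma lift_of_vertex:
  assumes "(l, w) \<in> lifts v" "w \<in> cube_vertices (cdim l)" "(l', w') \<in> lifts v"
  shows "w' \<in> cube_vertices (cdim l')"
proof -
  obtain h \<pi> s where "transports l w l' w' h \<pi> s" using ex_transport[OF assms(1,3)] .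
  then have "bij_betw \<pi> (free (cdim l') w') {}"
    using free_vertex[OF assms(2)] unfolding transports_def by simp
  then have "free (cdim l') w' = {}" by (simp add: bij_betw_def)
  then show ?thesis using assms(3) vertex_if_free_empty by (simp add: lifts_def)
qed

end

context CAT0_cubed_complex
begin

text \<open>The gap between the two largest displacements is a function with Lipschitz constant \<open>sqrt
  2\<close>.\<close>

lemma dominant_distance:
  assumes sep: "separated x \<epsilon>" and x: "x \<in> points"
    and y: "near x (\<epsilon>/2) l c y" and y': "near x (\<epsilon>/2) l' c' y'"
    and close: "length_dist x (p (l, y)) + length_dist (p (l, y)) (p (l', y')) < \<epsilon>/2"
    and dom: "dominant (cdim l) c y \<kappa>"
    and not_dom: "\<And>\<kappa>'. 0 < \<kappa>' \<Longrightarrow> \<not> dominant (cdim l') c' y' \<kappa>'"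
  shows "\<kappa> \<le> sqrt 2 * length_dist (p (l, y)) (p (l', y'))"
proof (rule ccontr)
  assume "\<not> ?thesis"
  then have less: "length_dist (p (l, y)) (p (l', y')) < \<kappa> / sqrt 2"
    by (simp add: less_divide_eq mult.commute)
  define Q where "Q t z \<longleftrightarrow> \<kappa> - sqrt 2 * t \<le> 0 \<or>
      (\<exists>l c y. near x (\<epsilon>/2) l c y \<and> p (l, y) = z \<and> dominant (cdim l) c y (\<kappa> - sqrt 2 * t))" for t z
  obtain r where r: "r < \<kappa> / sqrt 2" "Q r (p (l', y'))"
  proof (rule chart_induct[OF sep x near_points[OF y] near_points[OF y'] close _ _ less, of Q])
    fix l c y y' t
    assume y: "near x (\<epsilon>/2) l c y" and y': "near x (\<epsilon>/2) l c y'" and Q: "Q t (p (l, y))"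
    let ?D = "cube_dist (cdim l) y y'"
    show "Q (t + ?D) (p (l, y'))"
    proof (cases "\<kappa> - sqrt 2 * (t + ?D) \<le> 0")
      case True
      then show ?thesis by (simp add: Q_def)
    next
      case False
      moreover have "0 \<le> sqrt 2 * ?D" by simp
      ultimately have pos: "0 < \<kappa> - sqrt 2 * t" unfolding distrib_left by linarith
      then obtain l2 c2 y2 where y2: "near x (\<epsilon>/2) l2 c2 y2" "p (l2, y2) = p (l, y)"
          "dominant (cdim l2) c2 y2 (\<kappa> - sqrt 2 * t)"
        using Q unfolding Q_def by auto
      have "dominant (cdim l) c y (\<kappa> - sqrt 2 * t)"
        by (rule dominant_chart_change[OF sep y2(1) y y2(2,3) pos])
      from dominant_perturb[OF this, of y'] have "dominant (cdim l) c y' (\<kappa> - sqrt 2 * (t + ?D))"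
        by (simp add: algebra_simps)
      then show ?thesis using y' unfolding Q_def by blast
    qed
  next
    show "Q 0 (p (l, y))" using y dom unfolding Q_def by auto
  qed
  have pos: "0 < \<kappa> - sqrt 2 * r" using r(1) by (simp add: less_divide_eq mult.commute)
  then obtain l2 c2 y2 where y2: "near x (\<epsilon>/2) l2 c2 y2" "p (l2, y2) = p (l', y')"
      "dominant (cdim l2) c2 y2 (\<kappa> - sqrt 2 * r)"
    using r(2) unfolding Q_def by auto
  then show False using dominant_chart_change[OF sep y2(1) y' y2(2,3) pos] not_dom[OF pos] by blast
qed

text \<open>Suppose that two edges of a square at \<open>w\<close> are glued. For small \<open>t\<close>, write \<open>E r s\<close> for the
  point of the square with displacements \<open>r\<close> and \<open>s\<close>. The points \<open>E t 0\<close> and \<open>E 0 t\<close> have the same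
  image, whose distance from the image of \<open>E (t/2) (t/2)\<close> is exactly \<open>t / sqrt 2\<close> by
  \<open>dominant_distance\<close>. Hence both halves of the diagonal from \<open>E t 0\<close> to \<open>E 0 t\<close> are geodesics
  with common end points, although \<open>p\<close> separates their interiors.\<close>

lemma no_loops_in_link:
  assumes w: "(l, w) \<in> lifts v" "w \<in> cube_vertices (cdim l)" and bc: "b < cdim l" "c < cdim l"
    and eq: "p (l, nudge w b) = p (l, nudge w c)"
  shows "b = c"
proof (rule ccontr)
  assume "b \<noteq> c"
  let ?n = "cdim l"
  have l: "l \<in> \<Lambda>" and wc: "w \<in> unit_cube ?n" and vp: "v \<in> points"
    using w lifts_in_points by (auto simp: lifts_def)
  have wk: "w k = 0 \<or> w k = 1" if "k < ?n" for k using w(2) that by (simp add: cube_vertices_iff)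
  obtain \<epsilon> where sep: "separated v \<epsilon>" using ex_separated[OF vp] .
  define t where "t = \<epsilon>/16"
  have t: "0 < t" "t < 1" "\<epsilon> = 16 * t" using sep by (auto simp: separated_def t_def)
  define e where "e r s k = (if k = b then r else if k = c then s else 0 :: real)" for r s k
  define E where "E r s = corner ?n w (e r s)" for r s
  have e01: "0 \<le> e r s k \<and> e r s k \<le> 1" if "r \<in> {0..t}" "s \<in> {0..t}" for r s k
    using that t by (auto simp: e_def)
  have E_dist: "(cube_dist ?n (E r s) (E r' s'))\<^sup>2 = (r - r')\<^sup>2 + (s - s')\<^sup>2"
    if "r \<in> {0..t}" "s \<in> {0..t}" "r' \<in> {0..t}" "s' \<in> {0..t}" for r s r' s'
  proof -
    have "(cube_dist ?n (E r s) (E r' s'))\<^sup>2 = (\<Sum>k<?n. (e r s k - e r' s' k)\<^sup>2)"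
      unfolding E_def by (rule cube_dist_corner[OF w(2)]) (use e01 that in blast)+
    also have "\<dots> = (\<Sum>k\<in>{b, c}. (e r s k - e r' s' k)\<^sup>2)"
      by (rule sum.mono_neutral_right) (use bc in \<open>auto simp: e_def\<close>)
    finally show ?thesis using \<open>b \<noteq> c\<close> by (simp add: e_def)
  qed
  have E_cube: "E r s \<in> unit_cube ?n" if "r \<in> {0..t}" "s \<in> {0..t}" for r s
    unfolding E_def by (rule corner_props(1)[OF w(2)]) (use e01[OF that] in blast)
  have E_coord: "\<bar>E r s k - w k\<bar> = e r s k" if "r \<in> {0..t}" "s \<in> {0..t}" "k < ?n" for r s k
    unfolding E_def by (rule corner_props(2)[OF w(2) _ that(3)]) (use e01[OF that(1,2)] in blast)
  have "E 0 0 = w"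
  proof -
    have "e 0 0 = (\<lambda>_. 0)" by (auto simp: e_def fun_eq_iff)
    then show ?thesis unfolding E_def using corner_zero[OF w(2)] by simp
  qed
  have E_near': "cube_dist ?n w (E r s) \<le> 2 * t" if "r \<in> {0..t}" "s \<in> {0..t}" for r s
  proof -
    have "(cube_dist ?n w (E r s))\<^sup>2 = r\<^sup>2 + s\<^sup>2" using E_dist[of 0 0 r s] \<open>E 0 0 = w\<close> that t by simp
    also have "\<dots> \<le> t\<^sup>2 + t\<^sup>2" by (intro add_mono power_mono) (use that in auto)
    also have "\<dots> \<le> (2 * t)\<^sup>2" using t by (simp add: power2_eq_square)
    finally show ?thesis by (rule power2_le_imp_le) (use t in simp)
  qed
  then have E_near: "near v (\<epsilon>/2) l w (E r s)" if "r \<in> {0..t}" "s \<in> {0..t}" for r s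
    using E_near'[OF that] E_cube[OF that] w(1) t unfolding near_def by auto
  have dist_le: "length_dist (p (l, E r s)) (p (l, E r' s')) \<le> sqrt 2 * \<bar>r - r'\<bar>"
    if "r \<in> {0..t}" "s \<in> {0..t}" "r' \<in> {0..t}" "s' \<in> {0..t}" "\<bar>s - s'\<bar> = \<bar>r - r'\<bar>" for r s r' s'
  proof -
    have "(s - s')\<^sup>2 = (r - r')\<^sup>2" using that(5) by (metis power2_abs)
    then have "(cube_dist ?n (E r s) (E r' s'))\<^sup>2 = (sqrt 2 * \<bar>r - r'\<bar>)\<^sup>2"
      using E_dist[OF that(1-4)] by (simp add: power_mult_distrib)
    then have "cube_dist ?n (E r s) (E r' s') = sqrt 2 * \<bar>r - r'\<bar>"
      by (rule power2_eq_imp_eq) auto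
    then show ?thesis using length_dist_cube_le[OF l E_cube[OF that(1,2)] E_cube[OF that(3,4)]] by simp
  qed
  have in_range: "0 \<in> {0..t}" "t \<in> {0..t}" "t/2 \<in> {0..t}" "t/4 \<in> {0..t}" "3*t/4 \<in> {0..t}"
    using t by auto
  \<comment> \<open>The nudges mark the same end of the two edges, so the gluing of the edges preserves the
    displacement from \<open>w\<close>.\<close>
  have same: "p (l, E t 0) = p (l, E 0 t)"
  proof -
    have nb: "nudge w b \<in> unit_cube ?n" "nudge w c \<in> unit_cube ?n" using nudge_cube[OF wc] bc by auto
    have fr: "free ?n (nudge w b) = {b}" "free ?n (nudge w c) = {c}"
      using free_nudge[OF wc] bc free_vertex[OF w(2)] by simp_all
    have lc: "(l, nudge w c) \<in> lifts (p (l, nudge w b))" using l nb eq by (simp add: lifts_def)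
    obtain h \<pi> s where h: "transports l (nudge w b) l (nudge w c) h \<pi> s"
      using ex_transport[OF lift_self[OF l nb(1)] lc] .
    have "\<pi> c = b" using transports_perm[OF h] fr by blast
    have selfF: "nudge w b \<in> subcube ?n (nudge w b) (free ?n (nudge w b))" by (rule self_in_subcube[OF nb(1)])
    have EF: "E t 0 \<in> subcube ?n (nudge w b) (free ?n (nudge w b))"
    proof -
      have "E t 0 k = nudge w b k" if "k < ?n" "k \<noteq> b" for k
        using E_coord[of t 0 k] in_range that by (simp add: e_def nudge_def)
      then show ?thesis using E_cube in_range fr by (simp add: subcube_def)
    qed
    have "h (E t 0) = E 0 t"
    proof (rule unit_cube_eqI)
      show "h (E t 0) \<in> unit_cube ?n" using h EF subcube_subset unfolding transports_def by blast
      show "E 0 t \<in> unit_cube ?n" by (rule E_cube[OF in_range(1,2)])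
      fix k assume k: "k < ?n"
      show "h (E t 0) k = E 0 t k"
      proof (cases "k = c")
        case True
        have "h (E t 0) c = flip (s c) (E t 0 b)" "nudge w c c = flip (s c) (nudge w b b)"
          using transports_coord[OF h EF, of c] transports_coord[OF h selfF, of c] fr \<open>\<pi> c = b\<close> h
          unfolding transports_def by auto
        moreover have "E t 0 b = \<bar>w b - t\<bar>" "E 0 t c = \<bar>w c - t\<bar>"
          using bc \<open>b \<noteq> c\<close> by (auto simp: E_def corner_def e_def)
        ultimately show ?thesis
          unfolding True using wk[OF bc(1)] wk[OF bc(2)] t by (auto simp: nudge_def flip_def split: if_splits)
      next
        case False
        have "h (E t 0) k = nudge w c k" by (rule transports_fixed[OF h EF k]) (use fr False in simp)
        moreover have "e 0 t k = 0" using False by (simp add: e_def)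
        then have "E 0 t k = w k" using E_coord[OF in_range(1,2) k] by simp
        ultimately show ?thesis using False by (simp add: nudge_def)
      qed
    qed
    then show ?thesis using h EF unfolding transports_def by metis
  qed
  let ?x = "p (l, E t 0)" and ?m = "p (l, E (t/2) (t/2))"
  let ?q1 = "p (l, E (3*t/4) (t/4))" and ?q2 = "p (l, E (t/4) (3*t/4))"
  have pts: "?x \<in> points" "?m \<in> points" "?q1 \<in> points" "?q2 \<in> points"
    using near_points[OF E_near] in_range by blast+
  have xm: "length_dist ?x ?m \<le> sqrt 2 * (t/2)" using dist_le[of t 0 "t/2" "t/2"] in_range t by simp
  have "t \<le> sqrt 2 * length_dist ?x ?m"
  proof (rule dominant_distance[OF sep vp E_near E_near])
    show "dominant ?n w (E t 0) t"
      unfolding dominant_def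
      by (rule exI[of _ b]) (use bc E_coord[of t 0] in_range t in \<open>auto simp: e_def\<close>)
    fix \<kappa>' :: real assume \<kappa>': "0 < \<kappa>'"
    show "\<not> dominant ?n w (E (t/2) (t/2)) \<kappa>'"
    proof
      assume "dominant ?n w (E (t/2) (t/2)) \<kappa>'"
      then obtain i where i: "i < ?n" "\<kappa>' \<le> e (t/2) (t/2) i"
          "\<And>j. j < ?n \<Longrightarrow> j \<noteq> i \<Longrightarrow> e (t/2) (t/2) j + \<kappa>' \<le> e (t/2) (t/2) i"
        unfolding dominant_def using E_coord[OF in_range(3,3)] by auto
      then show False using i(3)[OF bc(1)] i(3)[OF bc(2)] \<kappa>' \<open>b \<noteq> c\<close> by (auto simp: e_def split: if_splits)
    qed
  next
    have "length_dist v ?x \<le> 2 * t"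
      using length_dist_cube_le[OF l wc E_cube[OF in_range(2,1)]] E_near'[OF in_range(2,1)] w(1) by (simp add: lifts_def)
    moreover have "sqrt 2 * (t/2) \<le> 2 * (t/2)"
      by (rule mult_right_mono) (use t real_le_lsqrt[of 2 2] in auto)
    ultimately show "length_dist v ?x + length_dist ?x ?m < \<epsilon>/2" using xm t by linarith
  qed (rule in_range)+
  then have "sqrt 2 * t \<le> sqrt 2 * (sqrt 2 * length_dist ?x ?m)" by (intro mult_left_mono) auto
  moreover have "sqrt 2 * (sqrt 2 * length_dist ?x ?m) = 2 * length_dist ?x ?m"
    by (simp flip: mult.assoc)
  ultimately have xm_ge: "sqrt 2 * t \<le> 2 * length_dist ?x ?m" by linarith
  have d1: "length_dist ?x ?q1 \<le> sqrt 2 * (t/4)" "length_dist ?q1 ?m \<le> sqrt 2 * (t/4)"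
    using dist_le[of t 0 "3*t/4" "t/4"] dist_le[of "3*t/4" "t/4" "t/2" "t/2"] in_range t by auto
  have d2: "length_dist ?x ?q2 \<le> sqrt 2 * (t/4)" "length_dist ?q2 ?m \<le> sqrt 2 * (t/4)"
    using dist_le[of 0 t "t/4" "3*t/4"] dist_le[of "t/4" "3*t/4" "t/2" "t/2"] in_range t same by auto
  have "length_dist ?x ?m \<le> length_dist ?x ?q1 + length_dist ?q1 ?m"
    "length_dist ?x ?m \<le> length_dist ?x ?q2 + length_dist ?q2 ?m"
    using triangle pts by blast+
  then have "length_dist ?x ?q1 + length_dist ?q1 ?m = length_dist ?x ?m"
    "length_dist ?x ?q2 = length_dist ?x ?q1" "length_dist ?q2 ?m = length_dist ?q1 ?m"
    using d1 d2 xm_ge by auto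
  then have "?q2 = ?q1"
    using CAT0_unique_between'[OF CAT0_points pts(1,2,3)] pts(4) by blast
  moreover have "free ?n (E r s) = {b, c}" if "r \<in> {0<..t}" "s \<in> {0<..t}" for r s
    unfolding E_def using corner_props(3)[OF w(2), of "e r s"] e01[of r s] that t bc
    by (auto simp: e_def split: if_splits)
  then have free: "free ?n (E (3*t/4) (t/4)) = {b, c}" "free ?n (E (t/4) (3*t/4)) = {b, c}" using t by auto
  moreover have "E (t/4) (3*t/4) \<in> subcube ?n (E (3*t/4) (t/4)) {b, c}"
    using E_cube in_range by (auto simp: subcube_def E_def corner_def e_def)
  ultimately have "E (3*t/4) (t/4) = E (t/4) (3*t/4)"
    using inj_on_open_face[OF l E_cube[OF in_range(5,4)] self_in_subcube[OF E_cube[OF in_range(5,4)]] order_refl,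
        of "E (t/4) (3*t/4)"] by simp
  then have "e (3*t/4) (t/4) b = e (t/4) (3*t/4) b"
    using E_coord[OF in_range(5,4) bc(1)] E_coord[OF in_range(4,5) bc(1)] by simp
  then show False using t by (simp add: e_def)
qed

end

section \<open>Locally convex subcomplexes span their faces\<close>

text \<open>Displacements of the points of the segment from \<open>\<delta>\<close> in all coordinates in \<open>A\<close>, at \<open>s = 0\<close>,
  to \<open>\<delta>\<close> in the coordinate \<open>a\<close>, at \<open>s = 1\<close>.\<close>

definition slide :: "nat \<Rightarrow> nat set \<Rightarrow> real \<Rightarrow> real \<Rightarrow> nat \<Rightarrow> real" where
  "slide a A \<delta> s k = (if k = a then s * \<delta> else if k \<in> A then (1 - s) * \<delta> else 0)"

lemma slide_01:
  assumes "0 \<le> \<delta>" "\<delta> \<le> 1" "s \<in> {0..1}"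
  shows "0 \<le> slide a A \<delta> s k" "slide a A \<delta> s k \<le> \<delta>" "slide a A \<delta> s k \<le> 1"
proof -
  have "s * \<delta> \<le> 1 * \<delta>" "(1 - s) * \<delta> \<le> 1 * \<delta>" using assms by (intro mult_right_mono; simp)+
  then show "0 \<le> slide a A \<delta> s k" "slide a A \<delta> s k \<le> \<delta>" "slide a A \<delta> s k \<le> 1"
    using assms by (auto simp: slide_def)
qed

lemma slide_dist:
  assumes w: "w \<in> cube_vertices n" and A: "insert a A \<subseteq> {..<n}" "a \<notin> A"
    and \<delta>: "0 \<le> \<delta>" "\<delta> \<le> 1" and st: "s \<in> {0..1}" "t \<in> {0..1}"
  shows "cube_dist n (corner n w (slide a A \<delta> s)) (corner n w (slide a A \<delta> t))
      = \<bar>s - t\<bar> * (\<delta> * sqrt (card (insert a A)))"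
    and "cube_dist n w (corner n w (slide a A \<delta> s)) \<le> \<delta> * sqrt (card (insert a A))"
proof -
  have "(cube_dist n (corner n w (slide a A \<delta> s)) (corner n w (slide a A \<delta> t)))\<^sup>2
      = (\<Sum>k<n. (slide a A \<delta> s k - slide a A \<delta> t k)\<^sup>2)"
    by (rule cube_dist_corner[OF w]) (use slide_01[OF \<delta>] st in auto)
  also have "\<dots> = (\<Sum>k\<in>insert a A. (slide a A \<delta> s k - slide a A \<delta> t k)\<^sup>2)"
    by (rule sum.mono_neutral_right) (use A in \<open>auto simp: slide_def\<close>)
  also have "\<dots> = (\<Sum>k\<in>insert a A. ((s - t) * \<delta>)\<^sup>2)"
  proof (rule sum.cong[OF refl])
    fix k assume "k \<in> insert a A"
    then have "slide a A \<delta> s k - slide a A \<delta> t k = (s - t) * \<delta> \<or> slide a A \<delta> s k - slide a A \<delta> t k = - ((s - t) * \<delta>)"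
      by (auto simp: slide_def algebra_simps)
    then show "(slide a A \<delta> s k - slide a A \<delta> t k)\<^sup>2 = ((s - t) * \<delta>)\<^sup>2" by auto
  qed
  also have "\<dots> = (\<bar>s - t\<bar> * (\<delta> * sqrt (card (insert a A))))\<^sup>2"
    by (simp add: power_mult_distrib mult_ac)
  finally show "cube_dist n (corner n w (slide a A \<delta> s)) (corner n w (slide a A \<delta> t))
      = \<bar>s - t\<bar> * (\<delta> * sqrt (card (insert a A)))"
    by (rule power2_eq_imp_eq) (use \<delta> in auto)
  have "(cube_dist n w (corner n w (slide a A \<delta> s)))\<^sup>2
      = (cube_dist n (corner n w (\<lambda>_. 0)) (corner n w (slide a A \<delta> s)))\<^sup>2"
    by (simp add: corner_zero[OF w])
  also have "\<dots> = (\<Sum>k<n. (0 - slide a A \<delta> s k)\<^sup>2)"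
    by (rule cube_dist_corner[OF w]) (use slide_01[OF \<delta> st(1)] in auto)
  also have "\<dots> = (\<Sum>k\<in>insert a A. (slide a A \<delta> s k)\<^sup>2)"
    by (rule sum.mono_neutral_cong_right) (use A in \<open>auto simp: slide_def\<close>)
  also have "\<dots> \<le> (\<Sum>k\<in>insert a A. \<delta>\<^sup>2)"
    by (intro sum_mono power_mono) (use slide_01[OF \<delta> st(1)] in auto)
  also have "\<dots> = (\<delta> * sqrt (card (insert a A)))\<^sup>2"
    by (simp add: power_mult_distrib mult_ac)
  finally show "cube_dist n w (corner n w (slide a A \<delta> s)) \<le> \<delta> * sqrt (card (insert a A))"
    by (rule power2_le_imp_le) (use \<delta> in simp)
qed

context CAT0_cubed_complex
begin

text \<open>The lower bound comes from the function \<open>f\<close>, in each cube the sum of the displacements with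
  coefficient 1 on the edge \<open>a\<close>, -1 on the edges \<open>A\<close> and 0 on all other edges. Edges are compared
  across cubes by the images of their nudges. By \<open>no_loops_in_link\<close> a cube has at most \<open>card A +
  1\<close> nonzero coefficients, and the Cauchy-Schwarz inequality bounds the Lipschitz constant of \<open>f\<close>
  by the square root of that number.\<close>

lemma opposite_corners_dist:
  assumes w: "(l, w) \<in> lifts v" "w \<in> cube_vertices (cdim l)" and A: "insert a A \<subseteq> {..<cdim l}" "a \<notin> A"
    and sep: "separated v \<epsilon>" and \<delta>: "0 < \<delta>" "2 * (\<delta> * sqrt (card (insert a A))) < \<epsilon>/2" "\<delta> \<le> 1"
  shows "\<delta> * sqrt (card (insert a A))
    \<le> length_dist (p (l, corner (cdim l) w (slide a A \<delta> 0))) (p (l, corner (cdim l) w (slide a A \<delta> 1)))"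
proof -
  let ?n = "cdim l"
  define B where "B = insert a A"
  define k where "k = card B"
  have finB: "finite B" unfolding B_def by (rule finite_subset[OF A(1)]) simp
  have kpos: "0 < k" using finB by (auto simp: k_def B_def card_gt_0_iff)
  have l: "l \<in> \<Lambda>" and wc: "w \<in> unit_cube ?n" and vp: "v \<in> points"
    using w lifts_in_points by (auto simp: lifts_def)
  define label where "label i = p (l, nudge w i)" for i
  have label_inj: "label i = label j \<longleftrightarrow> i = j" if "i \<in> B" "j \<in> B" for i j
    using no_loops_in_link[OF w, of i j] that A(1) unfolding label_def B_def by auto
  define C where "C z = (if z = label a then 1 else if z \<in> label ` A then -1 else 0 :: real)" for z
  define \<Phi> where "\<Phi> l' c' y' = (\<Sum>j<cdim l'. C (p (l', nudge c' j)) * \<bar>y' j - c' j\<bar>)" for l' c' y'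
  have compat: "\<Phi> l1 c1 y1 = \<Phi> l2 c2 y2"
    if y: "near v (\<epsilon>/2) l1 c1 y1" "near v (\<epsilon>/2) l2 c2 y2" and eq: "p (l1, y1) = p (l2, y2)" for l1 c1 y1 l2 c2 y2
  proof -
    obtain \<pi> where \<pi>: "bij_betw \<pi> (free (cdim l2) y2) (free (cdim l1) y1)"
      "\<forall>k\<in>free (cdim l2) y2. \<bar>y2 k - c2 k\<bar> = \<bar>y1 (\<pi> k) - c1 (\<pi> k)\<bar>"
      "\<forall>k\<in>free (cdim l2) y2. p (l1, nudge c1 (\<pi> k)) = p (l2, nudge c2 k)"
      using chart_change_coords[OF sep y eq] by blast
    have restrict: "\<Phi> l' c' y' = (\<Sum>j\<in>free (cdim l') y'. C (p (l', nudge c' j)) * \<bar>y' j - c' j\<bar>)"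
      if "near v (\<epsilon>/2) l' c' y'" for l' c' y'
      unfolding \<Phi>_def
      by (rule sum.mono_neutral_right) (use near_not_free[OF sep that] free_subset in auto)
    have "\<Phi> l2 c2 y2 = (\<Sum>j\<in>free (cdim l2) y2. C (p (l1, nudge c1 (\<pi> j))) * \<bar>y1 (\<pi> j) - c1 (\<pi> j)\<bar>)"
      unfolding restrict[OF y(2)] by (rule sum.cong) (use \<pi>(2,3) in auto)
    also have "\<dots> = \<Phi> l1 c1 y1"
      unfolding restrict[OF y(1)] by (rule sum.reindex_bij_betw[OF \<pi>(1)])
    finally show ?thesis by simp
  qed
  obtain f where f: "\<And>l' c' y'. near v (\<epsilon>/2) l' c' y' \<Longrightarrow> f (p (l', y')) = \<Phi> l' c' y'"
    using chart_function[of v "\<epsilon>/2" \<Phi>] compat by blast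
  have lip: "\<Phi> l' c' y' \<le> \<Phi> l' c' y + sqrt k * cube_dist (cdim l') y y'"
    if near: "near v (\<epsilon>/2) l' c' y" "near v (\<epsilon>/2) l' c' y'" for l' c' y y'
  proof -
    let ?C = "\<lambda>j. C (p (l', nudge c' j))"
    let ?J = "{j. j < cdim l' \<and> ?C j \<noteq> 0}"
    have c': "(l', c') \<in> lifts v" using near by (simp add: near_def)
    have c'v: "c' \<in> cube_vertices (cdim l')" by (rule lift_of_vertex[OF w c'])
    have "\<Phi> l' c' y' - \<Phi> l' c' y = (\<Sum>j<cdim l'. ?C j * (\<bar>y' j - c' j\<bar> - \<bar>y j - c' j\<bar>))"
      unfolding \<Phi>_def by (simp add: sum_subtractf right_diff_distrib)
    also have "\<dots> \<le> (\<Sum>j<cdim l'. \<bar>?C j\<bar> * \<bar>y j - y' j\<bar>)"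
    proof (rule sum_mono)
      fix j
      have "?C j * (\<bar>y' j - c' j\<bar> - \<bar>y j - c' j\<bar>) \<le> \<bar>?C j\<bar> * \<bar>\<bar>y' j - c' j\<bar> - \<bar>y j - c' j\<bar>\<bar>"
        by (metis abs_ge_self abs_mult)
      also have "\<dots> \<le> \<bar>?C j\<bar> * \<bar>y j - y' j\<bar>" by (rule mult_left_mono) auto
      finally show "?C j * (\<bar>y' j - c' j\<bar> - \<bar>y j - c' j\<bar>) \<le> \<bar>?C j\<bar> * \<bar>y j - y' j\<bar>" .
    qed
    also have "\<dots> \<le> L2_set ?C {..<cdim l'} * cube_dist (cdim l') y y'"
      unfolding cube_dist_def by (rule L2_set_mult_ineq)
    also have "L2_set ?C {..<cdim l'} \<le> sqrt k"
    proof -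
      have "(\<Sum>j<cdim l'. (?C j)\<^sup>2) = (\<Sum>j<cdim l'. if ?C j \<noteq> 0 then 1 else 0)"
        by (rule sum.cong) (auto simp: C_def)
      also have "\<dots> = card ?J"
      proof -
        have J: "?J = {j \<in> {..<cdim l'}. ?C j \<noteq> 0}" by auto
        show ?thesis unfolding J sum.inter_filter[OF finite_lessThan, symmetric] by simp
      qed
      also have "card ?J \<le> card (label ` B)"
      proof (rule card_inj_on_le)
        show "inj_on (\<lambda>j. p (l', nudge c' j)) ?J"
          using no_loops_in_link[OF c' c'v] by (auto intro!: inj_onI)
        show "(\<lambda>j. p (l', nudge c' j)) ` ?J \<subseteq> label ` B"
          by (auto simp: C_def B_def split: if_splits)
        show "finite (label ` B)" using finB by simp
      qed
      also have "card (label ` B) \<le> k" unfolding k_def by (rule card_image_le[OF finB])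
      finally show ?thesis by (simp add: L2_set_def)
    qed
    finally show ?thesis by (simp add: mult_right_mono)
  qed
  let ?y0 = "corner ?n w (slide a A \<delta> 0)" and ?y1 = "corner ?n w (slide a A \<delta> 1)"
  have \<delta>': "0 \<le> \<delta>" "\<delta> \<le> 1" using \<delta> by auto
  have cubes: "?y0 \<in> unit_cube ?n" "?y1 \<in> unit_cube ?n"
    by (rule corner_props(1)[OF w(2)]; use slide_01[OF \<delta>'] in simp)+
  have wdist: "cube_dist ?n w ?y0 \<le> \<delta> * sqrt k" "cube_dist ?n w ?y1 \<le> \<delta> * sqrt k"
    unfolding k_def B_def by (rule slide_dist(2)[OF w(2) A \<delta>', where t = 0]; simp)+
  have ydist: "cube_dist ?n ?y0 ?y1 = \<delta> * sqrt k"
    unfolding k_def B_def using slide_dist(1)[OF w(2) A \<delta>', of 0 1] by simp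
  have small: "2 * (\<delta> * sqrt k) < \<epsilon>/2" using \<delta>(2) by (simp add: k_def B_def)
  have pos: "0 \<le> \<delta> * sqrt k" using \<delta>' by simp
  have nears: "near v (\<epsilon>/2) l w ?y0" "near v (\<epsilon>/2) l w ?y1"
    unfolding near_def using w(1) cubes wdist small pos by auto
  have close: "length_dist v (p (l, ?y0)) + length_dist (p (l, ?y0)) (p (l, ?y1)) < \<epsilon>/2"
    using length_dist_cube_le[OF l wc cubes(1)] length_dist_cube_le[OF l cubes] wdist(1) ydist small w(1)
    by (simp add: lifts_def)
  have \<Phi>_eq: "\<Phi> l w (corner ?n w (slide a A \<delta> s)) = (\<Sum>j\<in>B. C (label j) * slide a A \<delta> s j)" if "s \<in> {0..1}" for s
  proof -
    have "\<Phi> l w (corner ?n w (slide a A \<delta> s)) = (\<Sum>j<?n. C (label j) * slide a A \<delta> s j)"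
      unfolding \<Phi>_def label_def
      by (rule sum.cong[OF refl]) (use corner_props(2)[OF w(2), of "slide a A \<delta> s"] slide_01[OF \<delta>' that] in simp)
    also have "\<dots> = (\<Sum>j\<in>B. C (label j) * slide a A \<delta> s j)"
      by (rule sum.mono_neutral_right) (use A in \<open>auto simp: slide_def B_def\<close>)
    finally show ?thesis .
  qed
  have Ca: "C (label a) = 1" by (simp add: C_def)
  have CA: "C (label j) = -1" if "j \<in> A" for j
    using label_inj[of j a] that A(2) by (auto simp: C_def B_def)
  have "\<Phi> l w ?y1 - \<Phi> l w ?y0 = (\<Sum>j\<in>B. C (label j) * (slide a A \<delta> 1 j - slide a A \<delta> 0 j))"
    unfolding \<Phi>_eq[of 0, simplified] \<Phi>_eq[of 1, simplified] by (simp add: sum_subtractf right_diff_distrib)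
  also have "\<dots> = (\<Sum>j\<in>B. \<delta>)"
    by (rule sum.cong[OF refl]) (use Ca CA A(2) in \<open>auto simp: slide_def B_def\<close>)
  finally have diff: "\<Phi> l w ?y1 - \<Phi> l w ?y0 = k * \<delta>" by (simp add: k_def)
  have sk: "0 < sqrt k" using kpos by simp
  have "f (p (l, ?y1)) / sqrt k - f (p (l, ?y0)) / sqrt k \<le> length_dist (p (l, ?y0)) (p (l, ?y1))"
  proof (rule chart_lipschitz[OF sep vp near_points[OF nears(1)] near_points[OF nears(2)] close])
    fix l' c' y y' assume near: "near v (\<epsilon>/2) l' c' y" "near v (\<epsilon>/2) l' c' y'"
    show "f (p (l', y')) / sqrt k \<le> f (p (l', y)) / sqrt k + cube_dist (cdim l') y y'"
      using lip[OF near] sk unfolding f[OF near(1)] f[OF near(2)] by (simp add: field_simps)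
  qed
  moreover have "f (p (l, ?y1)) / sqrt k - f (p (l, ?y0)) / sqrt k = \<delta> * (k / sqrt k)"
    unfolding f[OF nears(1)] f[OF nears(2)] diff_divide_distrib[symmetric] diff by simp
  moreover have "k / sqrt k = sqrt k" by (rule real_div_sqrt) simp
  ultimately have "\<delta> * sqrt k \<le> length_dist (p (l, ?y0)) (p (l, ?y1))" by metis
  then show ?thesis by (simp only: k_def B_def)
qed

text \<open>Edges are adjoined to a face one at a time; the midpoint of the segment \<open>y\<close> is interior to
  the enlarged face.\<close>

lemma spans_faces_if_locally_convex:
  assumes W: "subcomplex W" and conv: "locally_convex points length_dist W" and v: "v \<in> W"
  shows "spans_faces W v"
proof -
  have vp: "v \<in> points" using v subcomplex_subset_points[OF W] by blast
  obtain \<epsilon> where sep: "separated v \<epsilon>" using ex_separated[OF vp] .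
  obtain \<eta> where \<eta>: "0 < \<eta>" "geodesically_convex points length_dist (W \<inter> mball v \<eta>)"
    using conv v unfolding locally_convex_def by blast
  have "\<forall>y\<in>subcube (cdim l) w A. p (l, y) \<in> W"
    if w: "(l, w) \<in> lifts v" "w \<in> cube_vertices (cdim l)" and A: "A \<subseteq> {..<cdim l}"
      and edges: "\<forall>a\<in>A. p (l, nudge w a) \<in> W" for l w A
  proof -
    let ?n = "cdim l"
    have l: "l \<in> \<Lambda>" and wc: "w \<in> unit_cube ?n" using w by (auto simp: lifts_def)
    have "finite A" by (rule finite_subset[OF A]) simp
    then show ?thesis using A edges
    proof (induction A rule: finite_induct)
      case empty
      have "y = w" if "y \<in> subcube ?n w {}" for y
        using that wc by (auto simp: subcube_def intro: unit_cube_eqI)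
      then show ?case using w(1) v by (auto simp: lifts_def)
    next
      case (insert a A)
      have a: "a < ?n" "a \<notin> A" "insert a A \<subseteq> {..<?n}" using insert by auto
      have IH: "p (l, y) \<in> W" if "y \<in> subcube ?n w A" for y using insert that by auto
      define K where "K = sqrt (card (insert a A))"
      have K: "0 < K" using insert.hyps by (simp add: K_def card_gt_0_iff)
      \<comment> \<open>Small enough for both ends of the segment to lie in the ball \<open>mball v \<eta>\<close> and for
        \<open>opposite_corners_dist\<close> to apply.\<close>
      define \<delta> where "\<delta> = min (1/2) (min (\<epsilon> / (8 * K)) (\<eta> / (2 * K)))"
      have eps: "0 < \<epsilon>" using sep by (simp add: separated_def)
      have \<delta>: "0 < \<delta>" "\<delta> \<le> 1/2" using eps \<eta>(1) K by (auto simp: \<delta>_def)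
      have "\<delta> \<le> \<epsilon> / (8 * K)" "\<delta> \<le> \<eta> / (2 * K)" by (auto simp: \<delta>_def)
      then have "\<delta> * K \<le> \<epsilon> / 8" "\<delta> * K \<le> \<eta> / 2"
        using K by (auto simp: field_simps)
      then have small: "2 * (\<delta> * K) < \<epsilon>/2" "\<delta> * K < \<eta>" using eps \<eta>(1) by auto
      define D where "D = \<delta> * K"
      have D: "0 < D" using \<delta> K by (simp add: D_def)
      define y where "y s = corner ?n w (slide a A \<delta> s)" for s
      have \<delta>': "0 \<le> \<delta>" "\<delta> \<le> 1" using \<delta> by auto
      have y_cube: "y s \<in> unit_cube ?n" if "s \<in> {0..1}" for s
        unfolding y_def by (rule corner_props(1)[OF w(2)]) (use slide_01[OF \<delta>' that] in simp)
      have y_coord: "\<bar>y s k - w k\<bar> = slide a A \<delta> s k" if "s \<in> {0..1}" "k < ?n" for s k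
        unfolding y_def by (rule corner_props(2)[OF w(2) _ that(2)]) (use slide_01[OF \<delta>' that(1)] in simp)
      have y_in: "p (l, y 0) \<in> W" "p (l, y 1) \<in> W"
      proof -
        have "y 0 k = w k" if "k < ?n" "k \<notin> A" for k
          using y_coord[of 0 k] that by (simp add: slide_def split: if_splits)
        then have "y 0 \<in> subcube ?n w A" using y_cube[of 0] by (simp add: subcube_def)
        then show "p (l, y 0) \<in> W" by (rule IH)
        have "y 1 k = nudge w a k" if "k < ?n" "k \<noteq> a" for k
        proof -
          have "slide a A \<delta> 1 k = 0" using that by (simp add: slide_def)
          then show ?thesis using y_coord[of 1 k] that by (simp add: nudge_def)
        qed
        then have "y 1 \<in> subcube ?n (nudge w a) {a}" using y_cube[of 1] by (simp add: subcube_def)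
        moreover have "p (l, nudge w a) \<in> W" using insert.prems by simp
        ultimately show "p (l, y 1) \<in> W"
          using subcomplex_contains_face[OF W lift_self[OF l nudge_cube[OF wc a(1)]]] free_nudge[OF wc a(1)] by blast
      qed
      define \<gamma> where "\<gamma> t = p (l, y (t / D))" for t
      have range: "t / D \<in> {0..1}" if "t \<in> {0..D}" for t using that D by (auto simp: divide_le_eq)
      have \<gamma>_points: "\<gamma> t \<in> points" if "t \<in> {0..D}" for t
        using y_cube[OF range[OF that]] l by (auto simp: \<gamma>_def points_def)
      have \<gamma>_short: "length_dist (\<gamma> s) (\<gamma> t) \<le> \<bar>s - t\<bar>" if "s \<in> {0..D}" "t \<in> {0..D}" for s t
      proof -
        have "cube_dist ?n (y (s / D)) (y (t / D)) = \<bar>s / D - t / D\<bar> * D"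
          unfolding y_def D_def K_def by (rule slide_dist(1)[OF w(2) a(3,2) \<delta>']) (use range that in \<open>auto simp: D_def K_def\<close>)
        also have "\<dots> = \<bar>s - t\<bar>" using D by (simp add: diff_divide_distrib[symmetric])
        finally show ?thesis
          unfolding \<gamma>_def using length_dist_cube_le[OF l y_cube y_cube] range that by metis
      qed
      have ends: "\<gamma> 0 = p (l, y 0)" "\<gamma> D = p (l, y 1)" using D by (auto simp: \<gamma>_def)
      have "D \<le> length_dist (p (l, y 0)) (p (l, y 1))"
        unfolding D_def K_def y_def
        by (rule opposite_corners_dist[OF w a(3,2) sep]) (use \<delta> small(1) in \<open>auto simp: K_def\<close>)
      then have dist: "length_dist (\<gamma> 0) (\<gamma> D) = D"
        using \<gamma>_short[of 0 D] D ends by simp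
      have "geodesic_path points length_dist (\<gamma> 0) (\<gamma> D) \<gamma>"
        by (rule short_path_is_geodesic[OF \<gamma>_points \<gamma>_short dist])
      then have seg: "geodesic_segment points length_dist (\<gamma> 0) (\<gamma> D) (\<gamma> ` {0..D})"
        unfolding geodesic_segment_def using dist by (intro exI[of _ \<gamma>]) simp
      have ball: "p (l, y s) \<in> mball v \<eta>" if "s \<in> {0..1}" for s
      proof -
        have "cube_dist ?n w (y s) \<le> \<delta> * K"
          unfolding y_def K_def by (rule slide_dist(2)[OF w(2) a(3,2) \<delta>' that that])
        then have "length_dist v (p (l, y s)) < \<eta>"
          using length_dist_cube_le[OF l wc y_cube[OF that]] w(1) small(2) by (simp add: lifts_def)
        moreover have "p (l, y s) \<in> points" using y_cube[OF that] l by (auto simp: points_def)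
        ultimately show ?thesis using vp by simp
      qed
      have "\<gamma> 0 \<noteq> \<gamma> D"
      proof
        assume "\<gamma> 0 = \<gamma> D"
        moreover have "length_dist (\<gamma> D) (\<gamma> D) = 0" by (rule mdist_zero) (use \<gamma>_points D in simp)
        ultimately show False using dist D by simp
      qed
      moreover have "\<gamma> 0 \<in> W \<inter> mball v \<eta>" "\<gamma> D \<in> W \<inter> mball v \<eta>"
        using ends y_in ball[of 0] ball[of 1] by auto
      ultimately have "\<gamma> ` {0..D} \<subseteq> W \<inter> mball v \<eta>"
        using \<eta>(2) seg unfolding geodesically_convex_def by blast
      moreover have "D / 2 \<in> {0..D}" using D by simp
      ultimately have "\<gamma> (D / 2) \<in> W" by blast
      then have mid: "p (l, y (1/2)) \<in> W" using D by (simp add: \<gamma>_def)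
      have "free ?n (y (1/2)) = insert a A"
        unfolding y_def using corner_props(3)[OF w(2), of "slide a A \<delta> (1/2)"] slide_01[OF \<delta>', of "1/2" a A] \<delta> a
        by (auto simp: slide_def split: if_splits)
      moreover have "z \<in> subcube ?n (y (1/2)) (insert a A)" if "z \<in> subcube ?n w (insert a A)" for z
      proof -
        have "y (1/2) k = w k" if "k < ?n" "k \<notin> insert a A" for k
          using y_coord[of "1/2" k] that by (simp add: slide_def split: if_splits)
        then show ?thesis using that by (auto simp: subcube_def)
      qed
      moreover have "(l, y (1/2)) \<in> lifts (p (l, y (1/2)))" by (rule lift_self[OF l y_cube]) simp
      ultimately show ?case using subcomplex_contains_face[OF W _ mid] by blast
    qed
  qed
  then show ?thesis unfolding spans_faces_def by blast
qed

end

theorem theorem2p2: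
  fixes \<Lambda> :: "'i set" and cdim :: "'i \<Rightarrow> nat"
    and p :: "'i \<times> (nat \<Rightarrow> real) \<Rightarrow> 'x" and W :: "'x set"
  assumes "cubed_complex \<Lambda> cdim p"
    and "cubed_complex.finite_dimensional \<Lambda> cdim"
    and "cubed_complex.CAT0 \<Lambda> cdim p"
    and "cubed_complex.subcomplex \<Lambda> cdim p W"
  shows "locally_convex (cubed_complex.points \<Lambda> cdim p) (cubed_complex.length_dist \<Lambda> cdim p) W \<longleftrightarrow>
         cubed_complex.combinatorially_locally_convex \<Lambda> cdim p W"
proof -
  interpret CAT0_cubed_complex \<Lambda> cdim p
    using assms(1,3) by (simp add: CAT0_cubed_complex_def CAT0_cubed_complex_axioms_def)
  have "combinatorially_locally_convex W \<longleftrightarrow> (\<forall>v\<in>vertices \<inter> W. spans_faces W v)"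
    unfolding combinatorially_locally_convex_def using full_link_iff_spans_faces[OF assms(4)] by blast
  then show ?thesis
    using locally_convex_if_spans_faces[OF assms(4)] spans_faces_if_locally_convex[OF assms(4)] by blast
qed

end
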